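(* Let $(\mathcal A,\alpha)$ be a unital partial $G$-module. Consider the induced $K_{\mathrm{par}}(G)$-module structure on the underlying $K$-vector space of $\mathcal A$, given by $[g]\cdot a=\alpha_g(1_{g^{-1}}a)$. Then $H^0_{par}(G,\mathcal A)$ is a unital $K$-subalgebra of $\mathcal A$ and $$H^0(G,\mathcal A)=\mathcal U(H^0_{par}(G,\mathcal A)),$$ where $\mathcal U(R)$ denotes the group of invertible elements of $R$.
   Context: $K$ is a field and $G$ a group. A unital partial $G$-module is a pair $(\mathcal A,\alpha)$ with $\mathcal A$ a commutative (associative) $K$-algebra and $\alpha$ a unital partial action of $G$ on $\mathcal A$: ideals $\mathcal D_g=1_g\mathcal A$ with $1_g$ an idempotent of $\mathcal A$, and algebra isomorphisms $\alpha_g:\mathcal D_{g^{-1}}\to\mathcal D_g$ ($g\in G$) such that $\alpha_1=\mathrm{id}_{\mathcal A}$ (so $\mathcal D_1=\mathcal A$ is unital), and whenever $a\in\mathcal D_{h^{-1}}$ and $\alpha_h(a)\in\mathcal D_{g^{-1}}$, then $a\in\mathcal D_{(gh)^{-1}}$ and $\alpha_g(\alpha_h(a))=\alpha_{gh}(a)$. $\mathcal S(G)$ is the monoid generated by symbols $[g]$, $g\in G$, with relations $[g^{-1}][g][h]=[g^{-1}][gh]$, $[g][h][h^{-1}]=[gh][h^{-1}]$, $[g][1_G]=[g]$ (so $[1_G]$ is the identity); $e_g=[g][g^{-1}]$; $K_{\mathrm{par}}(G)=K\mathcal S(G)$ is the semigroup algebra. $H^0(G,\mathcal A)=\{a\in\mathcal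 U(\mathcal A)\mid\forall g\in G:\ \alpha_g(1_{g^{-1}}a)=1_ga\}$. For a left $K_{\mathrm{par}}(G)$-module $M$, $H^0_{par}(G,M)=\{m\in M\mid\forall g\in G:\ [g]\cdot m=e_g\cdot m\}$. *)

theory Defs
  imports "HOL-Algebra.Algebra"
begin

section \<open>Unital partial modules\<close>

text \<open>
  The partial action is given by the idempotents \<open>e g\<close> (written \<open>1\<^sub>g\<close> on paper) and the
  maps \<open>\<alpha> g\<close>; the values of \<open>\<alpha> g\<close> outside \<open>D (inv g)\<close> are irrelevant. The domain \<open>D g\<close> is
  the principal ideal of \<open>e g\<close>, which is a ring with identity \<open>e g\<close>.
\<close>

definition partial_dom :: "('a, 'm) ring_scheme \<Rightarrow> ('g \<Rightarrow> 'a) \<Rightarrow> 'g \<Rightarrow> 'a ring" where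
  "partial_dom A e g =
     \<lparr>carrier = PIdl\<^bsub>A\<^esub> (e g), monoid.mult = monoid.mult A, one = e g,
      ring.zero = ring.zero A, add = ring.add A\<rparr>"

locale unital_partial_module =
  K: field K + G: group G + A: algebra K A
  for K :: "('k, 'p) ring_scheme" (structure)
    and G :: "('g, 'q) monoid_scheme" (structure)
    and A :: "('k, 'a, 'r) module_scheme" (structure)
    and e :: "'g \<Rightarrow> 'a"
    and \<alpha> :: "'g \<Rightarrow> 'a \<Rightarrow> 'a" +
  assumes idem_closed: "g \<in> carrier G \<Longrightarrow> e g \<in> carrier A"
    and idem: "g \<in> carrier G \<Longrightarrow> e g \<otimes>\<^bsub>A\<^esub> e g = e g"
    and act_iso:
      "g \<in> carrier G \<Longrightarrow> \<alpha> g \<in> ring_iso (partial_dom A e (inv\<^bsub>G\<^esub> g)) (partial_dom A e g)"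
    and act_smult:
      "\<lbrakk>g \<in> carrier G; k \<in> carrier K; a \<in> PIdl\<^bsub>A\<^esub> (e (inv\<^bsub>G\<^esub> g))\<rbrakk>
        \<Longrightarrow> \<alpha> g (k \<odot>\<^bsub>A\<^esub> a) = k \<odot>\<^bsub>A\<^esub> \<alpha> g a"
    and dom_one: "PIdl\<^bsub>A\<^esub> (e \<one>\<^bsub>G\<^esub>) = carrier A"
    and act_one: "a \<in> carrier A \<Longrightarrow> \<alpha> \<one>\<^bsub>G\<^esub> a = a"
    and dom_mult:
      "\<lbrakk>g \<in> carrier G; h \<in> carrier G; a \<in> PIdl\<^bsub>A\<^esub> (e (inv\<^bsub>G\<^esub> h)); \<alpha> h a \<in> PIdl\<^bsub>A\<^esub> (e (inv\<^bsub>G\<^esub> g))\<rbrakk>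
        \<Longrightarrow> a \<in> PIdl\<^bsub>A\<^esub> (e (inv\<^bsub>G\<^esub> (g \<otimes>\<^bsub>G\<^esub> h)))"
    and act_mult:
      "\<lbrakk>g \<in> carrier G; h \<in> carrier G; a \<in> PIdl\<^bsub>A\<^esub> (e (inv\<^bsub>G\<^esub> h)); \<alpha> h a \<in> PIdl\<^bsub>A\<^esub> (e (inv\<^bsub>G\<^esub> g))\<rbrakk>
        \<Longrightarrow> \<alpha> g (\<alpha> h a) = \<alpha> (g \<otimes>\<^bsub>G\<^esub> h) a"

definition H0 ::
  "('g, 'q) monoid_scheme \<Rightarrow> ('a, 'm) ring_scheme \<Rightarrow> ('g \<Rightarrow> 'a) \<Rightarrow> ('g \<Rightarrow> 'a \<Rightarrow> 'a) \<Rightarrow> 'a set" where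
  "H0 G A e \<alpha> =
     {a \<in> Units A. \<forall>g \<in> carrier G. \<alpha> g (e (inv\<^bsub>G\<^esub> g) \<otimes>\<^bsub>A\<^esub> a) = e g \<otimes>\<^bsub>A\<^esub> a}"


section \<open>The monoid of the group and its monoid algebra\<close>

text \<open>
  The presentation is read as one of a semigroup: elements are classes of nonempty words over
  \<open>carrier G\<close>. The class of the letter \<open>\<one>\<close> is then a two-sided identity, a left one because
  \<open>[\<one>][g] = [g][inv g][g] = [g][\<one>] = [g]\<close> by the second, first and third relation.
\<close>

definition par_words :: "('g, 'q) monoid_scheme \<Rightarrow> 'g list set" where
  "par_words G = lists (carrier G) - {[]}"

inductive_set par_rel :: "('g, 'q) monoid_scheme \<Rightarrow> ('g list \<times> 'g list) set"
  for G (structure) where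
  rel_left: "\<lbrakk>g \<in> carrier G; h \<in> carrier G\<rbrakk> \<Longrightarrow> ([inv g, g, h], [inv g, g \<otimes> h]) \<in> par_rel G"
| rel_right: "\<lbrakk>g \<in> carrier G; h \<in> carrier G\<rbrakk> \<Longrightarrow> ([g, h, inv h], [g \<otimes> h, inv h]) \<in> par_rel G"
| rel_one: "g \<in> carrier G \<Longrightarrow> ([g, \<one>], [g]) \<in> par_rel G"
| refl: "u \<in> par_words G \<Longrightarrow> (u, u) \<in> par_rel G"
| sym: "(u, v) \<in> par_rel G \<Longrightarrow> (v, u) \<in> par_rel G"
| trans: "\<lbrakk>(u, v) \<in> par_rel G; (v, w) \<in> par_rel G\<rbrakk> \<Longrightarrow> (u, w) \<in> par_rel G"
| append: "\<lbrakk>(u, u') \<in> par_rel G; (v, v') \<in> par_rel G\<rbrakk> \<Longrightarrow> (u @ v, u' @ v') \<in> par_rel G"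

definition par_gen :: "('g, 'q) monoid_scheme \<Rightarrow> 'g \<Rightarrow> 'g list set" where
  "par_gen G g = par_rel G `` {[g]}"

definition par_monoid :: "('g, 'q) monoid_scheme \<Rightarrow> 'g list set monoid" where
  "par_monoid G =
     \<lparr>carrier = par_words G // par_rel G,
      monoid.mult = (\<lambda>a b. \<Union>u\<in>a. \<Union>v\<in>b. par_rel G `` {u @ v}),
      one = par_gen G \<one>\<^bsub>G\<^esub>\<rparr>"

definition par_idem :: "('g, 'q) monoid_scheme \<Rightarrow> 'g \<Rightarrow> 'g list set" where
  "par_idem G g = par_gen G g \<otimes>\<^bsub>par_monoid G\<^esub> par_gen G (inv\<^bsub>G\<^esub> g)"

text \<open>
  Elements of the algebra of \<open>S\<close> over \<open>K\<close> are the finitely supported functions \<open>S \<rightarrow> K\<close>,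
  extended by \<open>undefined\<close> outside \<open>carrier S\<close>; multiplication is convolution.
\<close>

definition supp_on :: "('k, 'p) ring_scheme \<Rightarrow> ('s, 'n) monoid_scheme \<Rightarrow> ('s \<Rightarrow> 'k) \<Rightarrow> 's set" where
  "supp_on K S f = {s \<in> carrier S. f s \<noteq> \<zero>\<^bsub>K\<^esub>}"

definition monomial :: "('k, 'p) ring_scheme \<Rightarrow> ('s, 'n) monoid_scheme \<Rightarrow> 's \<Rightarrow> 's \<Rightarrow> 'k" where
  "monomial K S s = (\<lambda>t\<in>carrier S. if t = s then \<one>\<^bsub>K\<^esub> else \<zero>\<^bsub>K\<^esub>)"

definition monoid_algebra ::
  "('k, 'p) ring_scheme \<Rightarrow> ('s, 'n) monoid_scheme \<Rightarrow> ('k, 's \<Rightarrow> 'k) module" where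
  "monoid_algebra K S =
     \<lparr>carrier = {f \<in> carrier S \<rightarrow>\<^sub>E carrier K. finite (supp_on K S f)},
      monoid.mult = (\<lambda>f g. \<lambda>s\<in>carrier S.
        \<Oplus>\<^bsub>K\<^esub>p \<in> {p \<in> supp_on K S f \<times> supp_on K S g. fst p \<otimes>\<^bsub>S\<^esub> snd p = s}.
          f (fst p) \<otimes>\<^bsub>K\<^esub> g (snd p)),
      one = monomial K S \<one>\<^bsub>S\<^esub>,
      ring.zero = (\<lambda>s\<in>carrier S. \<zero>\<^bsub>K\<^esub>),
      ring.add = (\<lambda>f g. \<lambda>s\<in>carrier S. f s \<oplus>\<^bsub>K\<^esub> g s),
      smult = (\<lambda>k f. \<lambda>s\<in>carrier S. k \<otimes>\<^bsub>K\<^esub> f s)\<rparr>"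

definition K_par ::
  "('k, 'p) ring_scheme \<Rightarrow> ('g, 'q) monoid_scheme \<Rightarrow> ('k, 'g list set \<Rightarrow> 'k) module" where
  "K_par K G = monoid_algebra K (par_monoid G)"

section \<open>Partial cohomology in degree zero\<close>

text \<open>
  The library's \<^locale>\<open>module\<close> requires a commutative ring of scalars. As there, the
  multiplicative fields of the record \<open>M\<close> play no role.
\<close>

locale left_module = R: ring R + M: abelian_group M
  for R :: "('r, 'p) ring_scheme" (structure) and M :: "('r, 'a, 'q) module_scheme" (structure) +
  assumes smult_closed:
      "\<lbrakk>r \<in> carrier R; x \<in> carrier M\<rbrakk> \<Longrightarrow> r \<odot>\<^bsub>M\<^esub> x \<in> carrier M"
    and smult_l_distr:
      "\<lbrakk>r \<in> carrier R; s \<in> carrier R; x \<in> carrier M\<rbrakk>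
        \<Longrightarrow> (r \<oplus>\<^bsub>R\<^esub> s) \<odot>\<^bsub>M\<^esub> x = r \<odot>\<^bsub>M\<^esub> x \<oplus>\<^bsub>M\<^esub> s \<odot>\<^bsub>M\<^esub> x"
    and smult_r_distr:
      "\<lbrakk>r \<in> carrier R; x \<in> carrier M; y \<in> carrier M\<rbrakk>
        \<Longrightarrow> r \<odot>\<^bsub>M\<^esub> (x \<oplus>\<^bsub>M\<^esub> y) = r \<odot>\<^bsub>M\<^esub> x \<oplus>\<^bsub>M\<^esub> r \<odot>\<^bsub>M\<^esub> y"
    and smult_assoc:
      "\<lbrakk>r \<in> carrier R; s \<in> carrier R; x \<in> carrier M\<rbrakk>
        \<Longrightarrow> (r \<otimes>\<^bsub>R\<^esub> s) \<odot>\<^bsub>M\<^esub> x = r \<odot>\<^bsub>M\<^esub> (s \<odot>\<^bsub>M\<^esub> x)"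
    and smult_one:
      "x \<in> carrier M \<Longrightarrow> \<one>\<^bsub>R\<^esub> \<odot>\<^bsub>M\<^esub> x = x"

definition H0_par ::
  "('k, 'p) ring_scheme \<Rightarrow> ('g, 'q) monoid_scheme
    \<Rightarrow> ('g list set \<Rightarrow> 'k, 'a, 'r) module_scheme \<Rightarrow> 'a set" where
  "H0_par K G M =
     {m \<in> carrier M. \<forall>g \<in> carrier G.
        monomial K (par_monoid G) (par_gen G g) \<odot>\<^bsub>M\<^esub> m =
        monomial K (par_monoid G) (par_idem G g) \<odot>\<^bsub>M\<^esub> m}"

text \<open>
  \<open>M\<close> is the \<open>K\<^sub>p\<^sub>a\<^sub>r(G)\<close>-module on the \<open>K\<close>-vector space underlying \<open>A\<close> with
  \<open>[g] \<cdot> a = \<alpha>\<^sub>g(1\<^bsub>inv g\<^esub> a)\<close>. A scalar \<open>k\<close> acts as the element \<open>k 1\<close> of \<open>K\<^sub>p\<^sub>a\<^sub>r(G)\<close>, so these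
  conditions determine \<open>\<odot>\<close> on the carriers.
\<close>

definition induced_par_module ::
  "('k, 'p) ring_scheme \<Rightarrow> ('g, 'q) monoid_scheme \<Rightarrow> ('k, 'a, 'r) module_scheme
    \<Rightarrow> ('g \<Rightarrow> 'a) \<Rightarrow> ('g \<Rightarrow> 'a \<Rightarrow> 'a) \<Rightarrow> ('g list set \<Rightarrow> 'k, 'a) module \<Rightarrow> bool" where
  "induced_par_module K G A e \<alpha> M \<longleftrightarrow>
     left_module (K_par K G) M \<and>
     carrier M = carrier A \<and> ring.add M = ring.add A \<and> ring.zero M = ring.zero A \<and>
     (\<forall>k \<in> carrier K. \<forall>a \<in> carrier A.
        (k \<odot>\<^bsub>K_par K G\<^esub> \<one>\<^bsub>K_par K G\<^esub>) \<odot>\<^bsub>M\<^esub> a = k \<odot>\<^bsub>A\<^esub> a) \<and>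
     (\<forall>g \<in> carrier G. \<forall>a \<in> carrier A.
        monomial K (par_monoid G) (par_gen G g) \<odot>\<^bsub>M\<^esub> a = \<alpha> g (e (inv\<^bsub>G\<^esub> g) \<otimes>\<^bsub>A\<^esub> a))"

definition unital_subalgebra ::
  "'a set \<Rightarrow> ('k, 'p) ring_scheme \<Rightarrow> ('k, 'a, 'r) module_scheme \<Rightarrow> bool" where
  "unital_subalgebra H K A \<longleftrightarrow> subring H A \<and> submodule H K A"

end

theory Submission
  imports Defs
begin

text \<open>
  Write \<open>act g a = \<alpha>\<^sub>g(1\<^bsub>inv g\<^esub> a)\<close>. The axioms of a partial action give
  \<open>\<alpha>\<^sub>h(1\<^bsub>inv h\<^esub> 1\<^bsub>inv (gh)\<^esub>) = 1\<^sub>h 1\<^bsub>inv g\<^esub>\<close>, whence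
  \<open>act g (act h a) = 1\<^sub>g act (gh) a = act (gh) (1\<^bsub>inv h\<^esub> a)\<close>. These two formulas imply that \<open>act\<close>
  respects the relations of \<open>S(G)\<close>, so it extends to \<open>S(G)\<close> and linearly to the semigroup algebra.
  With \<open>h = inv g\<close> they also show that \<open>e\<^sub>g\<close> acts as multiplication by \<open>1\<^sub>g\<close>. As \<open>act g\<close> is
  multiplicative, the elements with \<open>act g a = 1\<^sub>g a\<close> for all \<open>g\<close> form a subalgebra that contains
  the inverses of its elements that are invertible in \<open>A\<close>.
\<close>

section \<open>Partial actions\<close>

context unital_partial_module
begin

text \<open>The partial map \<open>\<alpha> g\<close> made total by projecting onto its domain
  first. It is the operator by which the generator of \<open>g\<close> has to act in the induced
  module.\<close>

definition act :: "'g \<Rightarrow> 'a \<Rightarrow> 'a" where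
  "act g a = \<alpha> g (e (inv\<^bsub>G\<^esub> g) \<otimes>\<^bsub>A\<^esub> a)"

text \<open>The idempotent \<open>e g\<close> is the identity of the ideal it generates, so
  membership turns into an equation. Intersections of domains can then be handled by multiplying
  idempotents.\<close>

lemma mem_dom_iff:
  assumes "g \<in> carrier G"
  shows "a \<in> PIdl\<^bsub>A\<^esub> (e g) \<longleftrightarrow> a \<in> carrier A \<and> e g \<otimes>\<^bsub>A\<^esub> a = a"
proof
  assume "a \<in> PIdl\<^bsub>A\<^esub> (e g)"
  then obtain x where "x \<in> carrier A" "a = x \<otimes>\<^bsub>A\<^esub> e g"
    by (auto simp: cgenideal_def)
  then show "a \<in> carrier A \<and> e g \<otimes>\<^bsub>A\<^esub> a = a"
    using idem_closed[OF assms] idem[OF assms] by (metis A.m_assoc A.m_closed A.m_comm)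
next
  assume "a \<in> carrier A \<and> e g \<otimes>\<^bsub>A\<^esub> a = a"
  then have "a = a \<otimes>\<^bsub>A\<^esub> e g" "a \<in> carrier A"
    using idem_closed[OF assms] A.m_comm by metis+
  then show "a \<in> PIdl\<^bsub>A\<^esub> (e g)"
    by (auto simp: cgenideal_def)
qed

lemma mult_mem_dom:
  assumes "g \<in> carrier G" "a \<in> PIdl\<^bsub>A\<^esub> (e g)" "b \<in> carrier A"
  shows "a \<otimes>\<^bsub>A\<^esub> b \<in> PIdl\<^bsub>A\<^esub> (e g)" "b \<otimes>\<^bsub>A\<^esub> a \<in> PIdl\<^bsub>A\<^esub> (e g)"
  using assms ideal.I_r_closed[OF A.cgenideal_ideal]
    ideal.I_l_closed[OF A.cgenideal_ideal] idem_closed by metis+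

lemma idem_mult_mem_dom:
  assumes "g \<in> carrier G" "a \<in> carrier A"
  shows "e g \<otimes>\<^bsub>A\<^esub> a \<in> PIdl\<^bsub>A\<^esub> (e g)"
  using A.cgenideal_self assms idem_closed mult_mem_dom(1) by simp

lemma iso_closed:
  assumes "g \<in> carrier G" "a \<in> PIdl\<^bsub>A\<^esub> (e (inv\<^bsub>G\<^esub> g))"
  shows "\<alpha> g a \<in> PIdl\<^bsub>A\<^esub> (e g)"
  using act_iso[OF assms(1)] assms(2)
  by (auto simp: ring_iso_def ring_hom_def partial_dom_def)

lemma iso_mult:
  assumes "g \<in> carrier G" "a \<in> PIdl\<^bsub>A\<^esub> (e (inv\<^bsub>G\<^esub> g))" "b \<in> PIdl\<^bsub>A\<^esub> (e (inv\<^bsub>G\<^esub> g))"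
  shows "\<alpha> g (a \<otimes>\<^bsub>A\<^esub> b) = \<alpha> g a \<otimes>\<^bsub>A\<^esub> \<alpha> g b"
  using act_iso[OF assms(1)] assms(2,3)
  by (auto simp: ring_iso_def ring_hom_def partial_dom_def)

lemma iso_add:
  assumes "g \<in> carrier G" "a \<in> PIdl\<^bsub>A\<^esub> (e (inv\<^bsub>G\<^esub> g))" "b \<in> PIdl\<^bsub>A\<^esub> (e (inv\<^bsub>G\<^esub> g))"
  shows "\<alpha> g (a \<oplus>\<^bsub>A\<^esub> b) = \<alpha> g a \<oplus>\<^bsub>A\<^esub> \<alpha> g b"
  using act_iso[OF assms(1)] assms(2,3)
  by (auto simp: ring_iso_def ring_hom_def partial_dom_def)

lemma iso_idem:
  assumes "g \<in> carrier G"
  shows "\<alpha> g (e (inv\<^bsub>G\<^esub> g)) = e g"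
  using act_iso[OF assms(1)]
  by (auto simp: ring_iso_def ring_hom_def partial_dom_def)

text \<open>The domain of the neutral element is all of \<open>A\<close>, and its idempotent acts on
  it as an identity.\<close>

lemma idem_one: "e \<one>\<^bsub>G\<^esub> = \<one>\<^bsub>A\<^esub>"
proof -
  have "\<one>\<^bsub>A\<^esub> \<in> PIdl\<^bsub>A\<^esub> (e \<one>\<^bsub>G\<^esub>)"
    using dom_one by simp
  then have "e \<one>\<^bsub>G\<^esub> \<otimes>\<^bsub>A\<^esub> \<one>\<^bsub>A\<^esub> = \<one>\<^bsub>A\<^esub>"
    using mem_dom_iff by blast
  then show ?thesis
    using idem_closed by simp
qed

text \<open>The composition axiom for \<open>g\<close> and \<open>inv g\<close> turns the composite
  into \<open>\<alpha> \<one>\<close>, which is the identity map.\<close>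

lemma iso_inv:
  assumes "g \<in> carrier G" "a \<in> PIdl\<^bsub>A\<^esub> (e g)"
  shows "\<alpha> g (\<alpha> (inv\<^bsub>G\<^esub> g) a) = a"
proof -
  have "\<alpha> (inv\<^bsub>G\<^esub> g) a \<in> PIdl\<^bsub>A\<^esub> (e (inv\<^bsub>G\<^esub> g))"
    using iso_closed[of "inv\<^bsub>G\<^esub> g" a] assms by simp
  then have "\<alpha> g (\<alpha> (inv\<^bsub>G\<^esub> g) a) = \<alpha> (g \<otimes>\<^bsub>G\<^esub> inv\<^bsub>G\<^esub> g) a"
    using act_mult[of g "inv\<^bsub>G\<^esub> g" a] assms by simp
  then show ?thesis
    using act_one assms mem_dom_iff by simp
qed

text \<open>The map \<open>\<alpha> h\<close> matches the intersection of the domains of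
  \<open>inv h\<close> and \<open>inv (g \<otimes> h)\<close> with that of the domains of
  \<open>h\<close> and \<open>inv g\<close>. The two products of idempotents are the identities of
  these intersections. The image \<open>u\<close> of the first identity lies in the second
  intersection, which gives \<open>?v \<otimes> u = u\<close>. The preimage \<open>w\<close> of the
  second identity lies in the first intersection, and applying \<open>\<alpha> h\<close> to
  \<open>w \<otimes> ?x = w\<close> gives \<open>?v \<otimes> u = ?v\<close>.\<close>

lemma iso_idem_mult:
  assumes g: "g \<in> carrier G" and h: "h \<in> carrier G"
  shows "\<alpha> h (e (inv\<^bsub>G\<^esub> h) \<otimes>\<^bsub>A\<^esub> e (inv\<^bsub>G\<^esub> (g \<otimes>\<^bsub>G\<^esub> h))) = e h \<otimes>\<^bsub>A\<^esub> e (inv\<^bsub>G\<^esub> g)"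
    (is "\<alpha> h ?x = ?v")
proof -
  let ?hi = "inv\<^bsub>G\<^esub> h" and ?gi = "inv\<^bsub>G\<^esub> g" and ?ghi = "inv\<^bsub>G\<^esub> (g \<otimes>\<^bsub>G\<^esub> h)"
  define u where "u = \<alpha> h ?x"
  define w where "w = \<alpha> ?hi ?v"
  have carr: "?hi \<in> carrier G" "?gi \<in> carrier G" "?ghi \<in> carrier G" "g \<otimes>\<^bsub>G\<^esub> h \<in> carrier G"
    using g h by auto
  note ecl = idem_closed[OF g] idem_closed[OF h] carr[THEN idem_closed]
  have x: "?x \<in> PIdl\<^bsub>A\<^esub> (e ?hi)" "?x \<in> PIdl\<^bsub>A\<^esub> (e ?ghi)"
    using A.cgenideal_self mult_mem_dom carr ecl by auto
  have v: "?v \<in> PIdl\<^bsub>A\<^esub> (e h)" "?v \<in> PIdl\<^bsub>A\<^esub> (e ?gi)"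
    using A.cgenideal_self mult_mem_dom carr ecl h by auto
  have u: "u \<in> PIdl\<^bsub>A\<^esub> (e h)"
    unfolding u_def using iso_closed h x by blast
  have back_x: "\<alpha> ?hi u = ?x"
    unfolding u_def using iso_inv[of ?hi ?x] carr x h by simp
  \<comment> \<open>The domain axiom for the pair \<open>g \<otimes> h\<close>,
    \<open>inv h\<close>, whose product is \<open>g\<close>: the map of \<open>inv h\<close> sends
    \<open>u\<close> back to \<open>?x\<close>, where \<open>\<alpha> (g \<otimes> h)\<close> is
    defined.\<close>
  have "u \<in> PIdl\<^bsub>A\<^esub> (e (inv\<^bsub>G\<^esub> ((g \<otimes>\<^bsub>G\<^esub> h) \<otimes>\<^bsub>G\<^esub> ?hi)))"
    using dom_mult[of "g \<otimes>\<^bsub>G\<^esub> h" ?hi u] carr u h back_x x by simp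
  then have u': "u \<in> PIdl\<^bsub>A\<^esub> (e ?gi)"
    using g h by (simp add: G.m_assoc)
  have w: "w \<in> PIdl\<^bsub>A\<^esub> (e ?hi)"
    unfolding w_def using iso_closed[of ?hi ?v] carr v h by simp
  have hw: "\<alpha> h w = ?v"
    unfolding w_def using iso_inv h v by blast
  have w': "w \<in> PIdl\<^bsub>A\<^esub> (e ?ghi)"
    using dom_mult[OF g h w] hw v by simp
  have wc: "w \<in> carrier A" "u \<in> carrier A"
    using w u mem_dom_iff carr h by auto
  have "w \<otimes>\<^bsub>A\<^esub> ?x = w"
    using w w' wc ecl carr mem_dom_iff by (metis A.m_assoc A.m_comm A.m_closed)
  then have "?v \<otimes>\<^bsub>A\<^esub> u = ?v"
    using iso_mult[OF h w x(1)] hw u_def by simp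
  moreover have "?v \<otimes>\<^bsub>A\<^esub> u = u"
    using u u' wc ecl carr h mem_dom_iff by (metis A.m_assoc A.m_comm A.m_closed)
  ultimately show ?thesis
    using u_def by simp
qed

section \<open>The total maps and their composition\<close>

lemma act_mem_dom:
  assumes "g \<in> carrier G" "a \<in> carrier A"
  shows "act g a \<in> PIdl\<^bsub>A\<^esub> (e g)"
  unfolding act_def using iso_closed idem_mult_mem_dom assms by simp

lemma act_closed [simp]:
  assumes "g \<in> carrier G" "a \<in> carrier A"
  shows "act g a \<in> carrier A"
  using act_mem_dom mem_dom_iff assms by blast

lemma idem_mult_act:
  assumes "g \<in> carrier G" "a \<in> carrier A"
  shows "e g \<otimes>\<^bsub>A\<^esub> act g a = act g a"
  using act_mem_dom mem_dom_iff assms by blast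

text \<open>Since the projecting factor is idempotent it can be doubled and given to both arguments;
  on the domain \<open>\<alpha> g\<close> is multiplicative.\<close>

lemma act_distrib_mult:
  assumes "g \<in> carrier G" "a \<in> carrier A" "b \<in> carrier A"
  shows "act g (a \<otimes>\<^bsub>A\<^esub> b) = act g a \<otimes>\<^bsub>A\<^esub> act g b"
proof -
  let ?f = "e (inv\<^bsub>G\<^esub> g)"
  have f: "?f \<in> carrier A" "?f \<otimes>\<^bsub>A\<^esub> ?f = ?f"
    using idem_closed idem assms by auto
  have "?f \<otimes>\<^bsub>A\<^esub> (a \<otimes>\<^bsub>A\<^esub> b) = (?f \<otimes>\<^bsub>A\<^esub> ?f) \<otimes>\<^bsub>A\<^esub> (a \<otimes>\<^bsub>A\<^esub> b)"
    using f by simp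
  also have "\<dots> = (?f \<otimes>\<^bsub>A\<^esub> a) \<otimes>\<^bsub>A\<^esub> (?f \<otimes>\<^bsub>A\<^esub> b)"
    using f(1) assms by (simp add: A.m_ac del: f(2))
  finally show ?thesis
    unfolding act_def using iso_mult idem_mult_mem_dom assms by simp
qed

lemma act_add:
  assumes "g \<in> carrier G" "a \<in> carrier A" "b \<in> carrier A"
  shows "act g (a \<oplus>\<^bsub>A\<^esub> b) = act g a \<oplus>\<^bsub>A\<^esub> act g b"
  unfolding act_def using iso_add idem_mult_mem_dom idem_closed assms by (simp add: A.r_distr)

lemma act_scale:
  assumes "g \<in> carrier G" "k \<in> carrier K" "a \<in> carrier A"
  shows "act g (k \<odot>\<^bsub>A\<^esub> a) = k \<odot>\<^bsub>A\<^esub> act g a"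
proof -
  let ?f = "e (inv\<^bsub>G\<^esub> g)"
  have "?f \<otimes>\<^bsub>A\<^esub> (k \<odot>\<^bsub>A\<^esub> a) = k \<odot>\<^bsub>A\<^esub> (?f \<otimes>\<^bsub>A\<^esub> a)"
    using idem_closed assms by (metis A.m_comm A.smult_assoc2 A.smult_closed G.inv_closed)
  then show ?thesis
    unfolding act_def using act_smult idem_mult_mem_dom assms by simp
qed

lemma act_one_right:
  assumes "g \<in> carrier G"
  shows "act g \<one>\<^bsub>A\<^esub> = e g"
  unfolding act_def using iso_idem idem_closed assms by simp

lemma act_one_left:
  assumes "a \<in> carrier A"
  shows "act \<one>\<^bsub>G\<^esub> a = a"
  unfolding act_def using act_one idem_one assms by simp

lemma act_idem:
  assumes "g \<in> carrier G" "h \<in> carrier G"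
  shows "act h (e (inv\<^bsub>G\<^esub> (g \<otimes>\<^bsub>G\<^esub> h))) = e h \<otimes>\<^bsub>A\<^esub> e (inv\<^bsub>G\<^esub> g)"
  unfolding act_def using iso_idem_mult assms by simp

lemma act_idem_mult:
  assumes "g \<in> carrier G" "a \<in> carrier A"
  shows "act g (e (inv\<^bsub>G\<^esub> g) \<otimes>\<^bsub>A\<^esub> a) = act g a"
  unfolding act_def using idem idem_closed assms by (simp flip: A.m_assoc)

text \<open>The composition axiom carries over to the total maps once the argument is cut down to
  the part where both maps of the composite are defined. The projection between \<open>act h\<close>
  and \<open>act g\<close> is pulled back along \<open>\<alpha> h\<close> by
  \<open>act_idem\<close>.\<close>

lemma act_act:
  assumes g: "g \<in> carrier G" and h: "h \<in> carrier G" and a: "a \<in> carrier A"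
  shows "act g (act h a) = act (g \<otimes>\<^bsub>G\<^esub> h) (e (inv\<^bsub>G\<^esub> h) \<otimes>\<^bsub>A\<^esub> a)"
proof -
  let ?hi = "inv\<^bsub>G\<^esub> h" and ?gi = "inv\<^bsub>G\<^esub> g" and ?ghi = "inv\<^bsub>G\<^esub> (g \<otimes>\<^bsub>G\<^esub> h)"
  \<comment> \<open>The factor \<open>e ?ghi\<close> is the pullback along \<open>\<alpha> h\<close>
    of the factor \<open>e ?gi\<close> that \<open>act g\<close> puts before \<open>act h a\<close>.
    Thus \<open>\<alpha> h b\<close> is exactly the argument which \<open>act g\<close> passes to
    \<open>\<alpha> g\<close>.\<close>
  define b where "b = e ?hi \<otimes>\<^bsub>A\<^esub> (e ?ghi \<otimes>\<^bsub>A\<^esub> a)"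
  have carr: "?hi \<in> carrier G" "?gi \<in> carrier G" "?ghi \<in> carrier G" "g \<otimes>\<^bsub>G\<^esub> h \<in> carrier G"
    using g h by auto
  note ecl = idem_closed[OF g] idem_closed[OF h] carr[THEN idem_closed]
  have b: "b \<in> PIdl\<^bsub>A\<^esub> (e ?hi)"
    unfolding b_def using idem_mult_mem_dom ecl carr a by simp
  have *: "\<alpha> h b = e ?gi \<otimes>\<^bsub>A\<^esub> act h a"
  proof -
    have "\<alpha> h b = act h (e ?ghi \<otimes>\<^bsub>A\<^esub> a)"
      by (simp add: act_def b_def)
    also have "\<dots> = (e h \<otimes>\<^bsub>A\<^esub> e ?gi) \<otimes>\<^bsub>A\<^esub> act h a"
      using act_distrib_mult act_idem g h a ecl by simp
    also have "\<dots> = e ?gi \<otimes>\<^bsub>A\<^esub> (e h \<otimes>\<^bsub>A\<^esub> act h a)"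
      using h a ecl by (simp add: A.m_ac)
    finally show ?thesis
      using idem_mult_act h a by simp
  qed
  have "\<alpha> h b \<in> PIdl\<^bsub>A\<^esub> (e ?gi)"
    using * idem_mult_mem_dom carr h a by simp
  then have "\<alpha> g (\<alpha> h b) = \<alpha> (g \<otimes>\<^bsub>G\<^esub> h) b"
    using act_mult g h b by blast
  \<comment> \<open>With the idempotents exchanged, \<open>b\<close> is the argument that
    \<open>act (g \<otimes> h)\<close> passes to its own map.\<close>
  moreover have "b = e ?ghi \<otimes>\<^bsub>A\<^esub> (e ?hi \<otimes>\<^bsub>A\<^esub> a)"
    unfolding b_def using ecl a by (simp add: A.m_ac)
  ultimately show ?thesis
    using * by (simp add: act_def)
qed

text \<open>Multiplicativity moves the inner idempotent of \<open>act_act\<close> to the outside.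
  There \<open>act_idem\<close>, for the pair \<open>inv g\<close> and \<open>g \<otimes> h\<close>
  with product \<open>h\<close>, yields \<open>e g\<close> and a factor
  \<open>e (g \<otimes> h)\<close> that \<open>act (g \<otimes> h) a\<close> absorbs.\<close>

lemma act_act_idem:
  assumes g: "g \<in> carrier G" and h: "h \<in> carrier G" and a: "a \<in> carrier A"
  shows "act g (act h a) = e g \<otimes>\<^bsub>A\<^esub> act (g \<otimes>\<^bsub>G\<^esub> h) a"
proof -
  have eq: "inv\<^bsub>G\<^esub> g \<otimes>\<^bsub>G\<^esub> (g \<otimes>\<^bsub>G\<^esub> h) = h"
    using g h by (simp flip: G.m_assoc)
  have gh: "g \<otimes>\<^bsub>G\<^esub> h \<in> carrier G"
    using g h by simp
  have "act g (act h a) = act (g \<otimes>\<^bsub>G\<^esub> h) (e (inv\<^bsub>G\<^esub> h)) \<otimes>\<^bsub>A\<^esub> act (g \<otimes>\<^bsub>G\<^esub> h) a"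
    using act_act act_distrib_mult g h a idem_closed by simp
  also have "act (g \<otimes>\<^bsub>G\<^esub> h) (e (inv\<^bsub>G\<^esub> h)) = e (g \<otimes>\<^bsub>G\<^esub> h) \<otimes>\<^bsub>A\<^esub> e g"
    using act_idem[of "inv\<^bsub>G\<^esub> g" "g \<otimes>\<^bsub>G\<^esub> h"] g h eq by simp
  also have "\<dots> \<otimes>\<^bsub>A\<^esub> act (g \<otimes>\<^bsub>G\<^esub> h) a = e g \<otimes>\<^bsub>A\<^esub> (e (g \<otimes>\<^bsub>G\<^esub> h) \<otimes>\<^bsub>A\<^esub> act (g \<otimes>\<^bsub>G\<^esub> h) a)"
    using g gh a idem_closed by (simp add: A.m_ac)
  finally show ?thesis
    using idem_mult_act gh a by simp
qed

text \<open>The case \<open>h = inv g\<close> of the previous formula. It lets the two notions of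
  invariants be compared: the idempotent of \<open>g\<close> in S(G) acts as multiplication by
  \<open>e g\<close>.\<close>

lemma act_act_inv:
  assumes "g \<in> carrier G" "a \<in> carrier A"
  shows "act g (act (inv\<^bsub>G\<^esub> g) a) = e g \<otimes>\<^bsub>A\<^esub> a"
  using act_act_idem[of g "inv\<^bsub>G\<^esub> g" a] assms act_one_left by simp

section \<open>Operators of words over the group\<close>

definition word_act :: "'g list \<Rightarrow> 'a \<Rightarrow> 'a" where
  "word_act w a = foldr act w a"

text \<open>The last letter of a word acts first, so concatenation becomes composition in the order
  that a left action requires.\<close>

lemma word_act_append: "word_act (u @ v) a = word_act u (word_act v a)"
  by (simp add: word_act_def)

lemma word_act_closed:
  assumes "w \<in> lists (carrier G)" "a \<in> carrier A"
  shows "word_act w a \<in> carrier A"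
  using assms by (induction w) (auto simp: word_act_def)

lemma word_act_add:
  assumes "w \<in> lists (carrier G)" "a \<in> carrier A" "b \<in> carrier A"
  shows "word_act w (a \<oplus>\<^bsub>A\<^esub> b) = word_act w a \<oplus>\<^bsub>A\<^esub> word_act w b"
  using assms
  by (induction w) (auto simp: word_act_def act_add word_act_closed[unfolded word_act_def])

lemma word_act_scale:
  assumes "w \<in> lists (carrier G)" "k \<in> carrier K" "a \<in> carrier A"
  shows "word_act w (k \<odot>\<^bsub>A\<^esub> a) = k \<odot>\<^bsub>A\<^esub> word_act w a"
  using assms
  by (induction w) (auto simp: word_act_def act_scale word_act_closed[unfolded word_act_def])

end

lemma (in group) par_rel_words:
  assumes "(u, v) \<in> par_rel G"
  shows "u \<in> par_words G \<and> v \<in> par_words G"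
  using assms by induction (auto simp: par_words_def)

text \<open>This makes the action descend to S(G). The first relation comes from
  \<open>act_act_idem\<close>, the second from \<open>act_act\<close>, the third from
  \<open>act \<one>\<close> being the identity; the closure rules preserve equality of
  operators.\<close>

lemma (in unital_partial_module) word_act_cong:
  assumes "(u, v) \<in> par_rel G" "a \<in> carrier A"
  shows "word_act u a = word_act v a"
  using assms
proof (induction arbitrary: a)
  case (rel_left g h)
  then have "act (inv\<^bsub>G\<^esub> g) (act g (act h a))
      = act (inv\<^bsub>G\<^esub> g) (e (inv\<^bsub>G\<^esub> (inv\<^bsub>G\<^esub> g)) \<otimes>\<^bsub>A\<^esub> act (g \<otimes>\<^bsub>G\<^esub> h) a)"
    using act_act_idem by simp
  \<comment> \<open>The factor \<open>e g\<close> produced by \<open>act_act_idem\<close> is the one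
    by which \<open>act (inv g)\<close> projects anyway.\<close>
  also have "\<dots> = act (inv\<^bsub>G\<^esub> g) (act (g \<otimes>\<^bsub>G\<^esub> h) a)"
    using rel_left by (intro act_idem_mult) auto
  finally show ?case
    by (simp add: word_act_def)
next
  \<comment> \<open>Here the inserted idempotent is \<open>e (inv h)\<close>, which fixes every
    value of \<open>act (inv h)\<close>.\<close>
  case (rel_right g h)
  then show ?case
    using act_act[of g h "act (inv\<^bsub>G\<^esub> h) a"] idem_mult_act[of "inv\<^bsub>G\<^esub> h" a]
    by (simp add: word_act_def)
next
  case (rel_one g)
  then show ?case
    by (simp add: word_act_def act_one_left)
next
  case (append u u' v v')
  \<comment> \<open>The induction hypothesis for the left factors is used at
    \<open>word_act v' a\<close>, which therefore has to lie in \<open>A\<close>.\<close>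
  have "v' \<in> lists (carrier G)"
    using G.par_rel_words append.hyps by (auto simp: par_words_def)
  then show ?case
    using append by (simp add: word_act_append word_act_closed)
qed simp_all

section \<open>The monoid of the group\<close>

lemma (in group) par_rel_equiv: "equiv (par_words G) (par_rel G)"
proof (rule equivI)
  show "par_rel G \<subseteq> par_words G \<times> par_words G"
    using par_rel_words by auto
  show "refl_on (par_words G) (par_rel G)"
    by (auto simp: refl_on_def intro: par_rel.refl)
  show "sym (par_rel G)"
    by (auto simp: sym_def intro: par_rel.sym)
  show "trans (par_rel G)"
    by (auto simp: trans_def intro: par_rel.trans)
qed

lemma par_words_append:
  "u \<in> par_words G \<Longrightarrow> v \<in> par_words G \<Longrightarrow> u @ v \<in> par_words G"
  by (auto simp: par_words_def)

lemma par_words_singleton: "g \<in> carrier G \<Longrightarrow> [g] \<in> par_words G"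
  by (simp add: par_words_def)

text \<open>The product of classes is a union over all representatives. Compatibility of
  \<open>par_rel\<close> with concatenation makes all members of this union the same class.\<close>

lemma (in group) par_monoid_mult:
  assumes "u \<in> par_words G" "v \<in> par_words G"
  shows "par_rel G `` {u} \<otimes>\<^bsub>par_monoid G\<^esub> par_rel G `` {v} = par_rel G `` {u @ v}"
proof -
  have cls: "par_rel G `` {u' @ v'} = par_rel G `` {u @ v}"
    if "u' \<in> par_rel G `` {u}" "v' \<in> par_rel G `` {v}" for u' v'
    using that equiv_class_eq[OF par_rel_equiv par_rel.append, of u u' v v'] by simp
  \<comment> \<open>The union of a constant family is that constant only over a nonempty index set;
    these are the witnesses.\<close>
  have self: "u \<in> par_rel G `` {u}" "v \<in> par_rel G `` {v}"
    using assms by (auto intro: par_rel.refl)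
  have "(\<Union>v'\<in>par_rel G `` {v}. par_rel G `` {u' @ v'}) = par_rel G `` {u @ v}"
    if "u' \<in> par_rel G `` {u}" for u'
    using cls[OF that] by (intro UN_constant_eq[OF self(2)] ballI)
  then have "(\<Union>u'\<in>par_rel G `` {u}. \<Union>v'\<in>par_rel G `` {v}. par_rel G `` {u' @ v'})
      = par_rel G `` {u @ v}"
    by (intro UN_constant_eq[OF self(1)] ballI)
  then show ?thesis
    by (simp add: par_monoid_def)
qed

lemma (in group) par_monoid_cases:
  assumes "s \<in> carrier (par_monoid G)"
  obtains u where "u \<in> par_words G" "s = par_rel G `` {u}"
  using assms by (auto simp: par_monoid_def elim: quotientE)

lemma (in group) par_class_closed:
  "u \<in> par_words G \<Longrightarrow> par_rel G `` {u} \<in> carrier (par_monoid G)"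
  by (simp add: par_monoid_def quotientI)

text \<open>The word \<open>[g, inv g, g]\<close> is contracted in two ways: the second relation
  merges its first two letters, the first relation its last two.\<close>

lemma (in group) par_rel_one_left:
  assumes "g \<in> carrier G"
  shows "([\<one>, g], [g]) \<in> par_rel G"
proof -
  have "([g, inv g, g], [\<one>, g]) \<in> par_rel G"
    using par_rel.rel_right[of g G "inv g"] assms by simp
  moreover have "([g, inv g, g], [g, \<one>]) \<in> par_rel G"
    using par_rel.rel_left[of "inv g" G g] assms by simp
  ultimately show ?thesis
    using par_rel.rel_one assms by (meson par_rel.sym par_rel.trans)
qed

text \<open>Associativity is that of concatenation. For the unit laws, a word is split at its first
  or last letter, next to which the letter \<open>\<one>\<close> is deleted.\<close>

lemma (in group) par_monoid_monoid: "monoid (par_monoid G)"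
proof (rule monoidI)
  have one: "\<one>\<^bsub>par_monoid G\<^esub> = par_rel G `` {[\<one>]}"
    by (simp add: par_monoid_def par_gen_def)
  show "\<one>\<^bsub>par_monoid G\<^esub> \<in> carrier (par_monoid G)"
    unfolding one by (simp add: par_class_closed par_words_singleton)
  show "s \<otimes>\<^bsub>par_monoid G\<^esub> t \<in> carrier (par_monoid G)"
    if "s \<in> carrier (par_monoid G)" "t \<in> carrier (par_monoid G)" for s t
    using that
    by (elim par_monoid_cases) (simp add: par_monoid_mult par_words_append par_class_closed)
  show "s \<otimes>\<^bsub>par_monoid G\<^esub> t \<otimes>\<^bsub>par_monoid G\<^esub> r = s \<otimes>\<^bsub>par_monoid G\<^esub> (t \<otimes>\<^bsub>par_monoid G\<^esub> r)"
    if "s \<in> carrier (par_monoid G)" "t \<in> carrier (par_monoid G)" "r \<in> carrier (par_monoid G)"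
    for s t r
    using that by (elim par_monoid_cases) (simp add: par_monoid_mult par_words_append)
  fix s assume "s \<in> carrier (par_monoid G)"
  then obtain u where u: "u \<in> par_words G" "s = par_rel G `` {u}"
    by (rule par_monoid_cases)
  obtain g w where gw: "u = g # w" "g \<in> carrier G" "w \<in> lists (carrier G)"
    using u(1) by (cases u) (auto simp: par_words_def)
  have "([\<one>] @ u, u) \<in> par_rel G"
  \<comment> \<open>Reflexivity of \<open>par_rel\<close> is available for nonempty words only, so
    one-letter words form a separate case.\<close>
  proof (cases "w = []")
    case True
    then show ?thesis
      using gw par_rel_one_left by simp
  next
    case False
    then have "(w, w) \<in> par_rel G"
      using gw by (intro par_rel.refl) (simp add: par_words_def)
    from par_rel.append[OF par_rel_one_left[OF gw(2)] this] show ?thesis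
      using gw by simp
  qed
  then show "\<one>\<^bsub>par_monoid G\<^esub> \<otimes>\<^bsub>par_monoid G\<^esub> s = s"
    using u one equiv_class_eq[OF par_rel_equiv]
    by (simp add: par_monoid_mult par_words_singleton)
  obtain h v where hv: "u = v @ [h]" "h \<in> carrier G" "v \<in> lists (carrier G)"
    using u(1) by (cases u rule: rev_cases) (auto simp: par_words_def)
  have "(u @ [\<one>], u) \<in> par_rel G"
  proof (cases "v = []")
    case True
    then show ?thesis
      using hv par_rel.rel_one by simp
  next
    case False
    then have "(v, v) \<in> par_rel G"
      using hv by (intro par_rel.refl) (simp add: par_words_def)
    from par_rel.append[OF this par_rel.rel_one[OF hv(2)]] show ?thesis
      using hv by simp
  qed
  then show "s \<otimes>\<^bsub>par_monoid G\<^esub> \<one>\<^bsub>par_monoid G\<^esub> = s"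
    using u one equiv_class_eq[OF par_rel_equiv]
    by (simp add: par_monoid_mult par_words_singleton)
qed

section \<open>Monoid algebras\<close>

text \<open>The value at \<open>f\<close> of the linear map on the monoid algebra that extends
  \<open>\<phi>\<close>. Restricting the sum to the support keeps it finite.\<close>

definition lin_ext ::
  "('k, 'p) ring_scheme \<Rightarrow> ('s, 'n) monoid_scheme \<Rightarrow> ('k, 'a, 'r) module_scheme
    \<Rightarrow> ('s \<Rightarrow> 'k) \<Rightarrow> ('s \<Rightarrow> 'a) \<Rightarrow> 'a" where
  "lin_ext K S M f \<phi> = (\<Oplus>\<^bsub>M\<^esub>s\<in>supp_on K S f. f s \<odot>\<^bsub>M\<^esub> \<phi> s)"

section \<open>Closure of the finitely supported functions under the operations\<close>

lemma monoid_algebra_carrierD: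
  assumes "f \<in> carrier (monoid_algebra K S)"
  shows "finite (supp_on K S f)" "\<And>s. s \<in> carrier S \<Longrightarrow> f s \<in> carrier K"
    "supp_on K S f \<subseteq> carrier S"
  using assms by (auto simp: monoid_algebra_def supp_on_def)

text \<open>A finite bound on the support is enough; sums and products may lose support points
  through cancellation, so their exact supports are inconvenient.\<close>

lemma monoid_algebra_carrierI:
  assumes "f \<in> carrier S \<rightarrow>\<^sub>E carrier K" "supp_on K S f \<subseteq> B" "finite B"
  shows "f \<in> carrier (monoid_algebra K S)"
  using assms finite_subset by (auto simp: monoid_algebra_def)

lemma monomial_closed:
  assumes "ring K"
  shows "monomial K S s \<in> carrier (monoid_algebra K S)"
proof -
  interpret ring K by fact
  show ?thesis
    by (rule monoid_algebra_carrierI[where B = "{s}"]) (auto simp: monomial_def supp_on_def)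
qed

lemma monoid_algebra_add_closed:
  assumes "ring K" and f: "f \<in> carrier (monoid_algebra K S)" and g: "g \<in> carrier (monoid_algebra K S)"
  shows "f \<oplus>\<^bsub>monoid_algebra K S\<^esub> g \<in> carrier (monoid_algebra K S)"
proof -
  interpret ring K by fact
  show ?thesis
    by (rule monoid_algebra_carrierI[where B = "supp_on K S f \<union> supp_on K S g"])
      (use monoid_algebra_carrierD[OF f] monoid_algebra_carrierD[OF g] in
        \<open>auto simp: monoid_algebra_def supp_on_def\<close>)
qed

lemma monoid_algebra_smult_closed:
  assumes "ring K" and k: "k \<in> carrier K" and f: "f \<in> carrier (monoid_algebra K S)"
  shows "k \<odot>\<^bsub>monoid_algebra K S\<^esub> f \<in> carrier (monoid_algebra K S)"
proof -
  interpret ring K by fact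
  show ?thesis
    by (rule monoid_algebra_carrierI[where B = "supp_on K S f"])
      (use k monoid_algebra_carrierD[OF f] in \<open>auto simp: monoid_algebra_def supp_on_def\<close>)
qed

lemma monoid_algebra_mult_apply:
  assumes "s \<in> carrier S"
  shows "(f \<otimes>\<^bsub>monoid_algebra K S\<^esub> g) s =
    (\<Oplus>\<^bsub>K\<^esub>p \<in> {p \<in> supp_on K S f \<times> supp_on K S g. fst p \<otimes>\<^bsub>S\<^esub> snd p = s}.
      f (fst p) \<otimes>\<^bsub>K\<^esub> g (snd p))"
  using assms by (simp add: monoid_algebra_def)

text \<open>At an element that is not a product of support elements the convolution sum is
  empty.\<close>

lemma monoid_algebra_mult_supp:
  assumes "ring K" "monoid S"
  shows "supp_on K S (f \<otimes>\<^bsub>monoid_algebra K S\<^esub> g) \<subseteq>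
    (\<lambda>p. fst p \<otimes>\<^bsub>S\<^esub> snd p) ` (supp_on K S f \<times> supp_on K S g)"
proof
  interpret ring K by fact
  fix s assume s: "s \<in> supp_on K S (f \<otimes>\<^bsub>monoid_algebra K S\<^esub> g)"
  show "s \<in> (\<lambda>p. fst p \<otimes>\<^bsub>S\<^esub> snd p) ` (supp_on K S f \<times> supp_on K S g)"
  proof (rule ccontr)
    assume "s \<notin> (\<lambda>p. fst p \<otimes>\<^bsub>S\<^esub> snd p) ` (supp_on K S f \<times> supp_on K S g)"
    then have empty: "{p \<in> supp_on K S f \<times> supp_on K S g. fst p \<otimes>\<^bsub>S\<^esub> snd p = s} = {}"
      by force
    have "s \<in> carrier S" "(f \<otimes>\<^bsub>monoid_algebra K S\<^esub> g) s \<noteq> \<zero>\<^bsub>K\<^esub>"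
      using s unfolding supp_on_def mem_Collect_eq by blast+
    moreover have "(f \<otimes>\<^bsub>monoid_algebra K S\<^esub> g) s = \<zero>\<^bsub>K\<^esub>" if "s \<in> carrier S"
      unfolding monoid_algebra_mult_apply[OF that] empty by simp
    ultimately show False
      by blast
  qed
qed

lemma monoid_algebra_mult_closed:
  assumes "ring K" "monoid S"
    and f: "f \<in> carrier (monoid_algebra K S)" and g: "g \<in> carrier (monoid_algebra K S)"
  shows "f \<otimes>\<^bsub>monoid_algebra K S\<^esub> g \<in> carrier (monoid_algebra K S)"
proof (rule monoid_algebra_carrierI[OF _ monoid_algebra_mult_supp[OF assms(1,2)]])
  interpret ring K by fact
  note f' = monoid_algebra_carrierD[OF f] and g' = monoid_algebra_carrierD[OF g]
  show "finite ((\<lambda>p. fst p \<otimes>\<^bsub>S\<^esub> snd p) ` (supp_on K S f \<times> supp_on K S g))"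
    using f' g' by simp
  have "(f \<otimes>\<^bsub>monoid_algebra K S\<^esub> g) s \<in> carrier K" if "s \<in> carrier S" for s
    unfolding monoid_algebra_mult_apply[OF that]
    using f' g' by (intro finsum_closed) (auto intro!: m_closed simp: subset_iff)
  then show "f \<otimes>\<^bsub>monoid_algebra K S\<^esub> g \<in> carrier S \<rightarrow>\<^sub>E carrier K"
    by (auto simp: monoid_algebra_def)
qed

section \<open>Linear extension into a module\<close>

context module
begin

lemma finsum_additive:
  assumes T: "\<And>x. x \<in> carrier M \<Longrightarrow> T x \<in> carrier M"
      "\<And>x y. x \<in> carrier M \<Longrightarrow> y \<in> carrier M \<Longrightarrow> T (x \<oplus>\<^bsub>M\<^esub> y) = T x \<oplus>\<^bsub>M\<^esub> T y"
    and "finite I" "\<phi> \<in> I \<rightarrow> carrier M"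
  shows "T (\<Oplus>\<^bsub>M\<^esub>i\<in>I. \<phi> i) = (\<Oplus>\<^bsub>M\<^esub>i\<in>I. T (\<phi> i))"
  using assms(3,4)
proof (induction)
  case empty
  \<comment> \<open>An additive map into a group preserves zero: its value there equals its own
    double and so cancels.\<close>
  have "T \<zero>\<^bsub>M\<^esub> \<oplus>\<^bsub>M\<^esub> T \<zero>\<^bsub>M\<^esub> = T \<zero>\<^bsub>M\<^esub>"
    using T(2)[of "\<zero>\<^bsub>M\<^esub>" "\<zero>\<^bsub>M\<^esub>"] by simp
  then show ?case
    using T(1)[of "\<zero>\<^bsub>M\<^esub>"] by (simp add: M.add.r_cancel_one)
next
  case (insert i I)
  then have "\<phi> \<in> I \<rightarrow> carrier M" "\<phi> i \<in> carrier M" "(\<lambda>i. T (\<phi> i)) \<in> I \<rightarrow> carrier M"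
    using T(1) by auto
  with insert show ?case
    using T by simp
qed

lemma finsum_smult_rdistr:
  assumes "finite I" "c \<in> I \<rightarrow> carrier R" "x \<in> carrier M"
  shows "(\<Oplus>i\<in>I. c i) \<odot>\<^bsub>M\<^esub> x = (\<Oplus>\<^bsub>M\<^esub>i\<in>I. c i \<odot>\<^bsub>M\<^esub> x)"
  using assms(1,2)
proof (induction)
  case (insert i I)
  then have "c \<in> I \<rightarrow> carrier R" "c i \<in> carrier R" "(\<lambda>i. c i \<odot>\<^bsub>M\<^esub> x) \<in> I \<rightarrow> carrier M"
    using assms(3) by auto
  with insert show ?case
    using assms(3) by (simp add: smult_l_distr)
qed (use assms(3) in simp)

text \<open>Elements outside the support contribute zero terms. Extensions of different functions
  can thus be compared over a common finite index set.\<close>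

lemma lin_ext_superset:
  assumes f: "f \<in> carrier (monoid_algebra R S)" and \<phi>: "\<phi> \<in> carrier S \<rightarrow> carrier M"
    and B: "finite B" "supp_on R S f \<subseteq> B" "B \<subseteq> carrier S"
  shows "lin_ext R S M f \<phi> = (\<Oplus>\<^bsub>M\<^esub>s\<in>B. f s \<odot>\<^bsub>M\<^esub> \<phi> s)"
  unfolding lin_ext_def
proof (rule M.add.finprod_mono_neutral_cong_left[OF B(1,2)])
  show "f s \<odot>\<^bsub>M\<^esub> \<phi> s = \<zero>\<^bsub>M\<^esub>" if "s \<in> B - supp_on R S f" for s
  proof -
    have "s \<in> carrier S" "f s = \<zero>"
      using that B(3) by (auto simp: supp_on_def)
    then show ?thesis
      using \<phi> by (simp add: Pi_iff)
  qed
  show "(\<lambda>s. f s \<odot>\<^bsub>M\<^esub> \<phi> s) \<in> B \<rightarrow> carrier M"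
    using B(3) \<phi> monoid_algebra_carrierD(2)[OF f] by auto
qed auto

lemma lin_ext_closed:
  assumes f: "f \<in> carrier (monoid_algebra R S)" and \<phi>: "\<phi> \<in> carrier S \<rightarrow> carrier M"
  shows "lin_ext R S M f \<phi> \<in> carrier M"
  unfolding lin_ext_def
  using \<phi> monoid_algebra_carrierD[OF f] by (intro M.finsum_closed) (auto simp: Pi_iff)

lemma lin_ext_cong:
  assumes f: "f \<in> carrier (monoid_algebra R S)" and \<phi>: "\<phi> \<in> carrier S \<rightarrow> carrier M"
    and "\<And>s. s \<in> carrier S \<Longrightarrow> \<phi> s = \<psi> s"
  shows "lin_ext R S M f \<phi> = lin_ext R S M f \<psi>"
  unfolding lin_ext_def
  using assms monoid_algebra_carrierD[OF f] by (intro M.finsum_cong') (auto simp: Pi_iff)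

lemma lin_ext_add_left:
  assumes f: "f \<in> carrier (monoid_algebra R S)" and g: "g \<in> carrier (monoid_algebra R S)"
    and \<phi>: "\<phi> \<in> carrier S \<rightarrow> carrier M"
  shows "lin_ext R S M (f \<oplus>\<^bsub>monoid_algebra R S\<^esub> g) \<phi>
    = lin_ext R S M f \<phi> \<oplus>\<^bsub>M\<^esub> lin_ext R S M g \<phi>"
proof -
  note f' = monoid_algebra_carrierD[OF f] and g' = monoid_algebra_carrierD[OF g]
  define B where "B = supp_on R S f \<union> supp_on R S g"
  have B: "finite B" "B \<subseteq> carrier S" "supp_on R S f \<subseteq> B" "supp_on R S g \<subseteq> B"
    using f' g' by (auto simp: B_def)
  have app: "(f \<oplus>\<^bsub>monoid_algebra R S\<^esub> g) s = f s \<oplus> g s" if "s \<in> carrier S" for s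
    using that by (simp add: monoid_algebra_def)
  have "supp_on R S (f \<oplus>\<^bsub>monoid_algebra R S\<^esub> g) \<subseteq> B"
    by (auto simp: B_def supp_on_def app)
  then have "lin_ext R S M (f \<oplus>\<^bsub>monoid_algebra R S\<^esub> g) \<phi>
      = (\<Oplus>\<^bsub>M\<^esub>s\<in>B. (f \<oplus>\<^bsub>monoid_algebra R S\<^esub> g) s \<odot>\<^bsub>M\<^esub> \<phi> s)"
    using lin_ext_superset monoid_algebra_add_closed[OF R.ring_axioms f g] \<phi> B by blast
  also have "\<dots> = (\<Oplus>\<^bsub>M\<^esub>s\<in>B. f s \<odot>\<^bsub>M\<^esub> \<phi> s \<oplus>\<^bsub>M\<^esub> g s \<odot>\<^bsub>M\<^esub> \<phi> s)"
    using B(2) \<phi> f' g' by (intro M.finsum_cong') (auto simp: app smult_l_distr Pi_iff subset_iff)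
  also have "\<dots> = (\<Oplus>\<^bsub>M\<^esub>s\<in>B. f s \<odot>\<^bsub>M\<^esub> \<phi> s) \<oplus>\<^bsub>M\<^esub> (\<Oplus>\<^bsub>M\<^esub>s\<in>B. g s \<odot>\<^bsub>M\<^esub> \<phi> s)"
    using B(2) \<phi> f' g' by (intro M.finsum_addf) (auto simp: Pi_iff subset_iff)
  finally show ?thesis
    using lin_ext_superset[OF f \<phi> B(1,3,2)] lin_ext_superset[OF g \<phi> B(1,4,2)] by simp
qed

lemma lin_ext_smult_left:
  assumes k: "k \<in> carrier R" and f: "f \<in> carrier (monoid_algebra R S)"
    and \<phi>: "\<phi> \<in> carrier S \<rightarrow> carrier M"
  shows "lin_ext R S M (k \<odot>\<^bsub>monoid_algebra R S\<^esub> f) \<phi> = k \<odot>\<^bsub>M\<^esub> lin_ext R S M f \<phi>"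
proof -
  note f' = monoid_algebra_carrierD[OF f]
  have app: "(k \<odot>\<^bsub>monoid_algebra R S\<^esub> f) s = k \<otimes> f s" if "s \<in> carrier S" for s
    using that by (simp add: monoid_algebra_def)
  have "supp_on R S (k \<odot>\<^bsub>monoid_algebra R S\<^esub> f) \<subseteq> supp_on R S f"
    using k by (auto simp: supp_on_def app)
  then have "lin_ext R S M (k \<odot>\<^bsub>monoid_algebra R S\<^esub> f) \<phi>
      = (\<Oplus>\<^bsub>M\<^esub>s\<in>supp_on R S f. (k \<odot>\<^bsub>monoid_algebra R S\<^esub> f) s \<odot>\<^bsub>M\<^esub> \<phi> s)"
    using lin_ext_superset monoid_algebra_smult_closed[OF R.ring_axioms k f] \<phi> f' by blast
  also have "\<dots> = (\<Oplus>\<^bsub>M\<^esub>s\<in>supp_on R S f. k \<odot>\<^bsub>M\<^esub> (f s \<odot>\<^bsub>M\<^esub> \<phi> s))"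
    using k \<phi> f' by (intro M.finsum_cong') (auto simp: app smult_assoc1 Pi_iff subset_iff)
  also have "\<dots> = k \<odot>\<^bsub>M\<^esub> lin_ext R S M f \<phi>"
    unfolding lin_ext_def using k \<phi> f'
    by (intro finsum_smult_ldistr[symmetric]) (auto simp: Pi_iff subset_iff)
  finally show ?thesis .
qed

lemma lin_ext_monomial:
  assumes s: "s \<in> carrier S" and \<phi>: "\<phi> \<in> carrier S \<rightarrow> carrier M"
  shows "lin_ext R S M (monomial R S s) \<phi> = \<phi> s"
proof -
  have "lin_ext R S M (monomial R S s) \<phi> = (\<Oplus>\<^bsub>M\<^esub>t\<in>{s}. monomial R S s t \<odot>\<^bsub>M\<^esub> \<phi> t)"
    by (rule lin_ext_superset[OF monomial_closed[OF R.ring_axioms] \<phi>])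
      (use s in \<open>auto simp: supp_on_def monomial_def\<close>)
  also have "\<dots> = \<phi> s"
    using s \<phi> by (simp add: Pi_iff monomial_def)
  finally show ?thesis .
qed

lemma lin_ext_add_right:
  assumes f: "f \<in> carrier (monoid_algebra R S)"
    and \<phi>: "\<phi> \<in> carrier S \<rightarrow> carrier M" and \<psi>: "\<psi> \<in> carrier S \<rightarrow> carrier M"
  shows "lin_ext R S M f (\<lambda>s. \<phi> s \<oplus>\<^bsub>M\<^esub> \<psi> s) = lin_ext R S M f \<phi> \<oplus>\<^bsub>M\<^esub> lin_ext R S M f \<psi>"
proof -
  note f' = monoid_algebra_carrierD[OF f]
  have "lin_ext R S M f (\<lambda>s. \<phi> s \<oplus>\<^bsub>M\<^esub> \<psi> s)
      = (\<Oplus>\<^bsub>M\<^esub>s\<in>supp_on R S f. f s \<odot>\<^bsub>M\<^esub> \<phi> s \<oplus>\<^bsub>M\<^esub> f s \<odot>\<^bsub>M\<^esub> \<psi> s)"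
    unfolding lin_ext_def using \<phi> \<psi> f'
    by (intro M.finsum_cong') (auto simp: smult_r_distr Pi_iff subset_iff)
  then show ?thesis
    unfolding lin_ext_def using \<phi> \<psi> f'
    by (subst M.finsum_addf[symmetric]) (auto simp: Pi_iff subset_iff)
qed

text \<open>Additivity carries \<open>T\<close> through the finite sum and homogeneity carries it
  past the coefficients. The maps \<open>T\<close> of interest are the operators of the elements of
  S(G).\<close>

lemma lin_ext_linear:
  assumes T: "\<And>x. x \<in> carrier M \<Longrightarrow> T x \<in> carrier M"
      "\<And>x y. x \<in> carrier M \<Longrightarrow> y \<in> carrier M \<Longrightarrow> T (x \<oplus>\<^bsub>M\<^esub> y) = T x \<oplus>\<^bsub>M\<^esub> T y"
      "\<And>k x. k \<in> carrier R \<Longrightarrow> x \<in> carrier M \<Longrightarrow> T (k \<odot>\<^bsub>M\<^esub> x) = k \<odot>\<^bsub>M\<^esub> T x"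
    and f: "f \<in> carrier (monoid_algebra R S)" and \<phi>: "\<phi> \<in> carrier S \<rightarrow> carrier M"
  shows "T (lin_ext R S M f \<phi>) = lin_ext R S M f (\<lambda>s. T (\<phi> s))"
proof -
  note f' = monoid_algebra_carrierD[OF f]
  have "T (lin_ext R S M f \<phi>) = (\<Oplus>\<^bsub>M\<^esub>s\<in>supp_on R S f. T (f s \<odot>\<^bsub>M\<^esub> \<phi> s))"
    unfolding lin_ext_def using T(1,2) \<phi> f'
    by (intro finsum_additive) (auto simp: Pi_iff subset_iff)
  also have "\<dots> = lin_ext R S M f (\<lambda>s. T (\<phi> s))"
    unfolding lin_ext_def using T \<phi> f'
    by (intro M.finsum_cong') (auto simp: Pi_iff subset_iff)
  finally show ?thesis .
qed

text \<open>Both sides are the sum of \<open>c p \<odot> \<phi> (m p)\<close> over all pairs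
  \<open>p\<close> of support elements. The convolution product groups the pairs by their product in
  \<open>S\<close>, the iterated extension by their first component.\<close>

lemma lin_ext_mult:
  assumes "monoid S"
    and f: "f \<in> carrier (monoid_algebra R S)" and g: "g \<in> carrier (monoid_algebra R S)"
    and \<phi>: "\<phi> \<in> carrier S \<rightarrow> carrier M"
  shows "lin_ext R S M (f \<otimes>\<^bsub>monoid_algebra R S\<^esub> g) \<phi>
    = lin_ext R S M f (\<lambda>s. lin_ext R S M g (\<lambda>t. \<phi> (s \<otimes>\<^bsub>S\<^esub> t)))"
proof -
  interpret S: monoid S by fact
  note f' = monoid_algebra_carrierD[OF f] and g' = monoid_algebra_carrierD[OF g]
  define m where "m = (\<lambda>p. fst p \<otimes>\<^bsub>S\<^esub> snd p)"
  define P where "P = supp_on R S f \<times> supp_on R S g"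
  define c where "c = (\<lambda>p. f (fst p) \<otimes> g (snd p))"
  \<comment> \<open>The fibres of the multiplication map on pairs, which index the convolution
    sums.\<close>
  define F where "F = (\<lambda>s. {p \<in> P. m p = s})"
  have P: "finite P" "\<And>p. p \<in> P \<Longrightarrow> m p \<in> carrier S" "\<And>p. p \<in> P \<Longrightarrow> c p \<in> carrier R"
    using f' g' by (auto simp: P_def m_def c_def subset_iff)
  have \<phi>': "\<And>s. s \<in> carrier S \<Longrightarrow> \<phi> s \<in> carrier M"
    using \<phi> by auto
  have F: "finite (F s)" "F s \<subseteq> P" for s
    using P(1) by (auto simp: F_def)
  have fsupp: "s \<in> carrier S" "f s \<in> carrier R" if "s \<in> supp_on R S f" for s
    using that f' by auto
  have gsupp: "s \<in> carrier S" "g s \<in> carrier R" if "s \<in> supp_on R S g" for s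
    using that g' by auto
  \<comment> \<open>The sum runs over all products of support elements instead of the support of the
    convolution, which cancellation may make smaller.\<close>
  have "lin_ext R S M (f \<otimes>\<^bsub>monoid_algebra R S\<^esub> g) \<phi>
      = (\<Oplus>\<^bsub>M\<^esub>s\<in>m ` P. (f \<otimes>\<^bsub>monoid_algebra R S\<^esub> g) s \<odot>\<^bsub>M\<^esub> \<phi> s)"
    by (rule lin_ext_superset[OF monoid_algebra_mult_closed[OF R.ring_axioms assms(1) f g] \<phi>])
      (use P monoid_algebra_mult_supp[OF R.ring_axioms assms(1), of f g] in
        \<open>auto simp: m_def P_def\<close>)
  also have "\<dots> = (\<Oplus>\<^bsub>M\<^esub>s\<in>m ` P. \<Oplus>\<^bsub>M\<^esub>p\<in>F s. c p \<odot>\<^bsub>M\<^esub> \<phi> (m p))"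
  proof (intro M.finsum_cong')
    fix s assume "s \<in> m ` P"
    then have s: "s \<in> carrier S"
      using P by auto
    have "(f \<otimes>\<^bsub>monoid_algebra R S\<^esub> g) s \<odot>\<^bsub>M\<^esub> \<phi> s = (\<Oplus>p\<in>F s. c p) \<odot>\<^bsub>M\<^esub> \<phi> s"
      unfolding monoid_algebra_mult_apply[OF s] by (simp add: F_def P_def m_def c_def)
    also have "\<dots> = (\<Oplus>\<^bsub>M\<^esub>p\<in>F s. c p \<odot>\<^bsub>M\<^esub> \<phi> s)"
      using P F s \<phi>' by (intro finsum_smult_rdistr) (auto simp: subset_iff)
    also have "\<dots> = (\<Oplus>\<^bsub>M\<^esub>p\<in>F s. c p \<odot>\<^bsub>M\<^esub> \<phi> (m p))"
      using P s \<phi>' by (intro M.finsum_cong') (auto simp: F_def)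
    finally show "(f \<otimes>\<^bsub>monoid_algebra R S\<^esub> g) s \<odot>\<^bsub>M\<^esub> \<phi> s
      = (\<Oplus>\<^bsub>M\<^esub>p\<in>F s. c p \<odot>\<^bsub>M\<^esub> \<phi> (m p))" .
  qed (use P \<phi>' in \<open>auto intro!: M.finsum_closed simp: F_def\<close>)
  \<comment> \<open>Distinct elements have disjoint fibres, so the double sum becomes a single sum
    over pairs.\<close>
  also have "\<dots> = (\<Oplus>\<^bsub>M\<^esub>p\<in>(\<Union>s\<in>m ` P. F s). c p \<odot>\<^bsub>M\<^esub> \<phi> (m p))"
    using P \<phi>' F(1)
    by (intro M.add.finprod_UN_disjoint[symmetric]) (auto simp: F_def pairwise_def disjnt_def)
  \<comment> \<open>The same set of pairs is now partitioned by the first component.\<close>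
  also have "(\<Union>s\<in>m ` P. F s) = (\<Union>s\<in>supp_on R S f. {s} \<times> supp_on R S g)"
    by (auto simp: F_def P_def)
  also have "(\<Oplus>\<^bsub>M\<^esub>p\<in>\<dots>. c p \<odot>\<^bsub>M\<^esub> \<phi> (m p))
      = (\<Oplus>\<^bsub>M\<^esub>s\<in>supp_on R S f. \<Oplus>\<^bsub>M\<^esub>p\<in>{s} \<times> supp_on R S g. c p \<odot>\<^bsub>M\<^esub> \<phi> (m p))"
    using P \<phi>' f' g'
    by (intro M.add.finprod_UN_disjoint) (auto simp: P_def pairwise_def disjnt_def)
  also have "\<dots> = lin_ext R S M f (\<lambda>s. lin_ext R S M g (\<lambda>t. \<phi> (s \<otimes>\<^bsub>S\<^esub> t)))"
    unfolding lin_ext_def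
  proof (intro M.finsum_cong')
    fix s assume s: "s \<in> supp_on R S f"
    have "(\<Oplus>\<^bsub>M\<^esub>p\<in>{s} \<times> supp_on R S g. c p \<odot>\<^bsub>M\<^esub> \<phi> (m p))
        = (\<Oplus>\<^bsub>M\<^esub>p\<in>Pair s ` supp_on R S g. c p \<odot>\<^bsub>M\<^esub> \<phi> (m p))"
      by (rule arg_cong[where f = "finsum M _"]) auto
    also have "\<dots> = (\<Oplus>\<^bsub>M\<^esub>t\<in>supp_on R S g. c (s, t) \<odot>\<^bsub>M\<^esub> \<phi> (m (s, t)))"
      using P \<phi>' s by (intro M.finsum_reindex) (auto simp: P_def inj_on_def)
    also have "\<dots> = (\<Oplus>\<^bsub>M\<^esub>t\<in>supp_on R S g. f s \<odot>\<^bsub>M\<^esub> (g t \<odot>\<^bsub>M\<^esub> \<phi> (s \<otimes>\<^bsub>S\<^esub> t)))"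
      using \<phi>' fsupp[OF s] gsupp
      by (intro M.finsum_cong') (auto simp: c_def m_def smult_assoc1)
    also have "\<dots> = f s \<odot>\<^bsub>M\<^esub> (\<Oplus>\<^bsub>M\<^esub>t\<in>supp_on R S g. g t \<odot>\<^bsub>M\<^esub> \<phi> (s \<otimes>\<^bsub>S\<^esub> t))"
      using \<phi>' fsupp[OF s] gsupp g'(1) by (intro finsum_smult_ldistr[symmetric]) auto
    finally show "(\<Oplus>\<^bsub>M\<^esub>p\<in>{s} \<times> supp_on R S g. c p \<odot>\<^bsub>M\<^esub> \<phi> (m p))
      = f s \<odot>\<^bsub>M\<^esub> (\<Oplus>\<^bsub>M\<^esub>t\<in>supp_on R S g. g t \<odot>\<^bsub>M\<^esub> \<phi> (s \<otimes>\<^bsub>S\<^esub> t))" .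
  qed (use \<phi>' fsupp gsupp in \<open>auto intro!: M.finsum_closed smult_closed\<close>)
  finally show ?thesis .
qed

end

section \<open>Coefficients as scalar-valued linear extensions\<close>

definition self_module :: "('k, 'p) ring_scheme \<Rightarrow> ('k, 'k) module" where
  "self_module K = \<lparr>carrier = carrier K, monoid.mult = monoid.mult K, one = one K,
     ring.zero = ring.zero K, add = ring.add K, smult = monoid.mult K\<rparr>"

lemma self_module_simps [simp]:
  "carrier (self_module K) = carrier K" "ring.add (self_module K) = ring.add K"
  "ring.zero (self_module K) = ring.zero K" "smult (self_module K) = monoid.mult K"
  by (simp_all add: self_module_def)

lemma (in cring) self_module: "module R (self_module R)"
proof (rule moduleI)
  show "abelian_group (self_module R)"
    by (rule abelian_groupI) (auto simp: a_ac intro: l_neg)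
qed (auto simp: cring_axioms l_distr r_distr m_assoc)

text \<open>Against the indicator function of \<open>s\<close> only the term at \<open>s\<close>
  survives. Inserting \<open>s\<close> into the index set also covers the case where
  \<open>f\<close> vanishes at \<open>s\<close>.\<close>

lemma (in cring) lin_ext_delta:
  assumes f: "f \<in> carrier (monoid_algebra R S)" and s: "s \<in> carrier S"
  shows "lin_ext R S (self_module R) f (\<lambda>t. if t = s then \<one> else \<zero>) = f s"
proof -
  interpret N: module R "self_module R"
    by (rule self_module)
  note f' = monoid_algebra_carrierD[OF f]
  have "lin_ext R S (self_module R) f (\<lambda>t. if t = s then \<one> else \<zero>)
      = (\<Oplus>\<^bsub>self_module R\<^esub>t\<in>insert s (supp_on R S f). f t \<otimes> (if t = s then \<one> else \<zero>))"
    by (subst N.lin_ext_superset[OF f, where B = "insert s (supp_on R S f)"]) (use f' s in auto)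
  also have "\<dots> = (\<Oplus>\<^bsub>self_module R\<^esub>t\<in>{s}. f t)"
    using f' s by (intro N.M.add.finprod_mono_neutral_cong_right) (auto simp: subset_iff)
  also have "\<dots> = f s"
    using f' s N.M.finsum_insert[of "{}" s f] by simp
  finally show ?thesis .
qed

text \<open>
  The evaluations at the elements of \<open>S\<close> are linear extensions, so identities in the monoid
  algebra can be tested on linear extensions.
\<close>

lemma (in cring) monoid_algebra_eqI:
  assumes f: "f \<in> carrier (monoid_algebra R S)" and g: "g \<in> carrier (monoid_algebra R S)"
    and eq: "\<And>\<phi>. \<phi> \<in> carrier S \<rightarrow> carrier R
      \<Longrightarrow> lin_ext R S (self_module R) f \<phi> = lin_ext R S (self_module R) g \<phi>"
  shows "f = g"
proof (rule extensionalityI)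
  show "f \<in> extensional (carrier S)" "g \<in> extensional (carrier S)"
    using f g by (auto simp: monoid_algebra_def PiE_def)
  show "f s = g s" if "s \<in> carrier S" for s
    using lin_ext_delta[OF f that] lin_ext_delta[OF g that]
      eq[of "\<lambda>t. if t = s then \<one> else \<zero>"] by simp
qed

text \<open>Tested on \<open>\<phi>\<close>, the product unfolds by \<open>lin_ext_mult\<close> into
  two nested evaluations, giving the value of \<open>\<phi>\<close> at the product of
  \<open>s\<close> and \<open>t\<close>; no convolution sum has to be computed.\<close>

lemma (in cring) monomial_mult:
  assumes "monoid S" and s: "s \<in> carrier S" and t: "t \<in> carrier S"
  shows "monomial R S s \<otimes>\<^bsub>monoid_algebra R S\<^esub> monomial R S t = monomial R S (s \<otimes>\<^bsub>S\<^esub> t)"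
proof -
  interpret S: monoid S by fact
  interpret N: module R "self_module R"
    by (rule self_module)
  note cl = monomial_closed[OF ring_axioms]
  show ?thesis
  proof (rule monoid_algebra_eqI[OF monoid_algebra_mult_closed[OF ring_axioms assms(1) cl cl] cl])
    fix \<phi> assume \<phi>: "\<phi> \<in> carrier S \<rightarrow> carrier R"
    have *: "lin_ext R S (self_module R) (monomial R S t) (\<lambda>y. \<phi> (x \<otimes>\<^bsub>S\<^esub> y)) = \<phi> (x \<otimes>\<^bsub>S\<^esub> t)"
      if "x \<in> carrier S" for x
      using that t \<phi> by (intro N.lin_ext_monomial) auto
    have "lin_ext R S (self_module R) (monomial R S s)
        (\<lambda>x. lin_ext R S (self_module R) (monomial R S t) (\<lambda>y. \<phi> (x \<otimes>\<^bsub>S\<^esub> y))) = \<phi> (s \<otimes>\<^bsub>S\<^esub> t)"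
      using s t \<phi> * by (subst N.lin_ext_monomial) auto
    then show "lin_ext R S (self_module R)
        (monomial R S s \<otimes>\<^bsub>monoid_algebra R S\<^esub> monomial R S t) \<phi>
      = lin_ext R S (self_module R) (monomial R S (s \<otimes>\<^bsub>S\<^esub> t)) \<phi>"
      using N.lin_ext_mult[OF assms(1) cl cl, of \<phi>] N.lin_ext_monomial[of "s \<otimes>\<^bsub>S\<^esub> t" S \<phi>] s t \<phi>
      by simp
  qed
qed

section \<open>Ring structure of the monoid algebra\<close>

lemma (in cring) monoid_algebra_abelian_group: "abelian_group (monoid_algebra R S)"
proof (rule abelian_groupI)
  let ?A = "monoid_algebra R S"
  have ext: "f = g" if "f \<in> carrier ?A" "g \<in> carrier ?A" "\<And>s. s \<in> carrier S \<Longrightarrow> f s = g s" for f g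
    using that by (intro extensionalityI[where A = "carrier S"]) (auto simp: monoid_algebra_def PiE_def)
  have add: "(f \<oplus>\<^bsub>?A\<^esub> g) s = f s \<oplus> g s" if "s \<in> carrier S" for f g s
    using that by (simp add: monoid_algebra_def)
  have zero: "\<zero>\<^bsub>?A\<^esub> s = \<zero>" if "s \<in> carrier S" for s
    using that by (simp add: monoid_algebra_def)
  note cl = monoid_algebra_add_closed[OF ring_axioms]
  show zc: "\<zero>\<^bsub>?A\<^esub> \<in> carrier ?A"
    by (rule monoid_algebra_carrierI[where B = "{}"]) (auto simp: monoid_algebra_def supp_on_def)
  fix f assume f: "f \<in> carrier ?A"
  note fc = monoid_algebra_carrierD(2)[OF f]
  show "\<zero>\<^bsub>?A\<^esub> \<oplus>\<^bsub>?A\<^esub> f = f"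
    using cl[OF zc f] f by (rule ext) (simp add: add zero fc)
  \<comment> \<open>The additive inverse is taken as the multiple by minus one because closure under
    scalars is already known.\<close>
  define g where "g = \<ominus> \<one> \<odot>\<^bsub>?A\<^esub> f"
  have g: "g \<in> carrier ?A"
    unfolding g_def by (intro monoid_algebra_smult_closed[OF ring_axioms]) (use f in auto)
  have "g \<oplus>\<^bsub>?A\<^esub> f = \<zero>\<^bsub>?A\<^esub>"
    using cl[OF g f] zc
  proof (rule ext)
    fix s assume s: "s \<in> carrier S"
    have "g s = \<ominus> f s"
      using s fc by (simp add: g_def monoid_algebra_def l_minus)
    then show "(g \<oplus>\<^bsub>?A\<^esub> f) s = \<zero>\<^bsub>?A\<^esub> s"
      using s fc by (simp add: add zero l_neg)
  qed
  then show "\<exists>g\<in>carrier ?A. g \<oplus>\<^bsub>?A\<^esub> f = \<zero>\<^bsub>?A\<^esub>"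
    using g by blast
  fix g assume g: "g \<in> carrier ?A"
  note gc = monoid_algebra_carrierD(2)[OF g]
  show "f \<oplus>\<^bsub>?A\<^esub> g \<in> carrier ?A"
    by (rule cl[OF f g])
  show "f \<oplus>\<^bsub>?A\<^esub> g = g \<oplus>\<^bsub>?A\<^esub> f"
    using cl[OF f g] cl[OF g f] by (rule ext) (simp add: add fc gc a_comm)
  fix h assume h: "h \<in> carrier ?A"
  show "f \<oplus>\<^bsub>?A\<^esub> g \<oplus>\<^bsub>?A\<^esub> h = f \<oplus>\<^bsub>?A\<^esub> (g \<oplus>\<^bsub>?A\<^esub> h)"
    using cl[OF cl[OF f g] h] cl[OF f cl[OF g h]]
    by (rule ext) (simp add: add fc gc monoid_algebra_carrierD(2)[OF h] a_assoc)
qed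

text \<open>Each law involving products is tested on an arbitrary \<open>\<phi>\<close>. After
  \<open>lin_ext_mult\<close> has replaced convolutions by nested extensions, the unit and
  associative laws reduce to those of \<open>S\<close>, and distributivity to additivity of
  \<open>lin_ext\<close>.\<close>

lemma (in cring) monoid_algebra_ring:
  assumes "monoid S"
  shows "ring (monoid_algebra R S)"
proof -
  interpret S: monoid S by fact
  interpret N: module R "self_module R"
    by (rule self_module)
  let ?A = "monoid_algebra R S" and ?L = "lin_ext R S (self_module R)"
  note addc = monoid_algebra_add_closed[OF ring_axioms]
  note mulc = monoid_algebra_mult_closed[OF ring_axioms assms]
  have one: "\<one>\<^bsub>?A\<^esub> = monomial R S \<one>\<^bsub>S\<^esub>"
    by (simp add: monoid_algebra_def)
  have onec: "\<one>\<^bsub>?A\<^esub> \<in> carrier ?A"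
    unfolding one by (rule monomial_closed[OF ring_axioms])
  \<comment> \<open>The inner extension is again a scalar-valued function on \<open>S\<close>, as
    required of the argument of the outer one.\<close>
  have closed: "(\<lambda>s. ?L f (\<lambda>t. \<phi> (s \<otimes>\<^bsub>S\<^esub> t))) \<in> carrier S \<rightarrow> carrier R"
    if "f \<in> carrier ?A" "\<phi> \<in> carrier S \<rightarrow> carrier R" for f \<phi>
    using N.lin_ext_closed[OF that(1)] that(2) by (auto simp: Pi_iff)
  have mult: "?L (f \<otimes>\<^bsub>?A\<^esub> g) \<phi> = ?L f (\<lambda>s. ?L g (\<lambda>t. \<phi> (s \<otimes>\<^bsub>S\<^esub> t)))"
    if "f \<in> carrier ?A" "g \<in> carrier ?A" "\<phi> \<in> carrier S \<rightarrow> carrier R" for f g \<phi>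
    using N.lin_ext_mult[OF assms that(1,2)] that(3) by simp
  have add: "?L (f \<oplus>\<^bsub>?A\<^esub> g) \<phi> = ?L f \<phi> \<oplus> ?L g \<phi>"
    if "f \<in> carrier ?A" "g \<in> carrier ?A" "\<phi> \<in> carrier S \<rightarrow> carrier R" for f g \<phi>
    using N.lin_ext_add_left[OF that(1,2)] that(3) by simp
  have cong: "?L f \<phi> = ?L f \<psi>"
    if "f \<in> carrier ?A" "\<phi> \<in> carrier S \<rightarrow> carrier R" "\<And>s. s \<in> carrier S \<Longrightarrow> \<phi> s = \<psi> s"
    for f \<phi> \<psi>
    using N.lin_ext_cong[OF that(1) _ that(3)] that(2) by simp
  have shift: "(\<lambda>t. \<phi> (s \<otimes>\<^bsub>S\<^esub> t)) \<in> carrier S \<rightarrow> carrier R"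
    if "s \<in> carrier S" "\<phi> \<in> carrier S \<rightarrow> carrier R" for s \<phi>
    using that by auto
  show ?thesis
  proof (rule ringI[OF monoid_algebra_abelian_group])
    show "monoid ?A"
    proof (rule monoidI)
      fix f assume f: "f \<in> carrier ?A"
      show "\<one>\<^bsub>?A\<^esub> \<otimes>\<^bsub>?A\<^esub> f = f"
      proof (rule monoid_algebra_eqI[OF mulc[OF onec f] f])
        fix \<phi> assume \<phi>: "\<phi> \<in> carrier S \<rightarrow> carrier R"
        have "?L (\<one>\<^bsub>?A\<^esub> \<otimes>\<^bsub>?A\<^esub> f) \<phi> = ?L f (\<lambda>t. \<phi> (\<one>\<^bsub>S\<^esub> \<otimes>\<^bsub>S\<^esub> t))"
          unfolding mult[OF onec f \<phi>] unfolding one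
          using closed[OF f \<phi>] by (subst N.lin_ext_monomial) auto
        also have "\<dots> = ?L f \<phi>"
          using \<phi> by (intro cong[OF f]) auto
        finally show "?L (\<one>\<^bsub>?A\<^esub> \<otimes>\<^bsub>?A\<^esub> f) \<phi> = ?L f \<phi>" .
      qed
      show "f \<otimes>\<^bsub>?A\<^esub> \<one>\<^bsub>?A\<^esub> = f"
      proof (rule monoid_algebra_eqI[OF mulc[OF f onec] f])
        fix \<phi> assume \<phi>: "\<phi> \<in> carrier S \<rightarrow> carrier R"
        have "?L \<one>\<^bsub>?A\<^esub> (\<lambda>t. \<phi> (s \<otimes>\<^bsub>S\<^esub> t)) = \<phi> s" if "s \<in> carrier S" for s
          unfolding one using \<phi> that by (subst N.lin_ext_monomial) auto
        then show "?L (f \<otimes>\<^bsub>?A\<^esub> \<one>\<^bsub>?A\<^esub>) \<phi> = ?L f \<phi>"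
          unfolding mult[OF f onec \<phi>] using closed[OF onec \<phi>] by (intro cong[OF f]) auto
      qed
      fix g assume g: "g \<in> carrier ?A"
      show "f \<otimes>\<^bsub>?A\<^esub> g \<in> carrier ?A"
        by (rule mulc[OF f g])
      fix h assume h: "h \<in> carrier ?A"
      show "f \<otimes>\<^bsub>?A\<^esub> g \<otimes>\<^bsub>?A\<^esub> h = f \<otimes>\<^bsub>?A\<^esub> (g \<otimes>\<^bsub>?A\<^esub> h)"
      proof (rule monoid_algebra_eqI[OF mulc[OF mulc[OF f g] h] mulc[OF f mulc[OF g h]]])
        fix \<phi> assume \<phi>: "\<phi> \<in> carrier S \<rightarrow> carrier R"
        \<comment> \<open>Associativity of \<open>S\<close> enters here, inside the two inner
          extensions.\<close>
        have inner: "?L g (\<lambda>t. ?L h (\<lambda>r. \<phi> (s \<otimes>\<^bsub>S\<^esub> t \<otimes>\<^bsub>S\<^esub> r))) = ?L (g \<otimes>\<^bsub>?A\<^esub> h) (\<lambda>t. \<phi> (s \<otimes>\<^bsub>S\<^esub> t))"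
          if s: "s \<in> carrier S" for s
          unfolding mult[OF g h shift[OF s \<phi>]]
        proof (rule cong[OF g])
          show "(\<lambda>t. ?L h (\<lambda>r. \<phi> (s \<otimes>\<^bsub>S\<^esub> t \<otimes>\<^bsub>S\<^esub> r))) \<in> carrier S \<rightarrow> carrier R"
            using closed[OF h \<phi>] s by auto
          show "?L h (\<lambda>r. \<phi> (s \<otimes>\<^bsub>S\<^esub> t \<otimes>\<^bsub>S\<^esub> r)) = ?L h (\<lambda>r. \<phi> (s \<otimes>\<^bsub>S\<^esub> (t \<otimes>\<^bsub>S\<^esub> r)))"
            if "t \<in> carrier S" for t
            using s that \<phi> by (intro cong[OF h]) (auto simp: S.m_assoc)
        qed
        have "?L (f \<otimes>\<^bsub>?A\<^esub> g \<otimes>\<^bsub>?A\<^esub> h) \<phi>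
            = ?L f (\<lambda>s. ?L g (\<lambda>t. ?L h (\<lambda>r. \<phi> (s \<otimes>\<^bsub>S\<^esub> t \<otimes>\<^bsub>S\<^esub> r))))"
          by (simp only: mult[OF mulc[OF f g] h \<phi>] mult[OF f g closed[OF h \<phi>]])
        also have "\<dots> = ?L f (\<lambda>s. ?L (g \<otimes>\<^bsub>?A\<^esub> h) (\<lambda>t. \<phi> (s \<otimes>\<^bsub>S\<^esub> t)))"
          using closed[OF g closed[OF h \<phi>]] inner by (rule cong[OF f])
        also have "\<dots> = ?L (f \<otimes>\<^bsub>?A\<^esub> (g \<otimes>\<^bsub>?A\<^esub> h)) \<phi>"
          by (simp only: mult[OF f mulc[OF g h] \<phi>])
        finally show "?L (f \<otimes>\<^bsub>?A\<^esub> g \<otimes>\<^bsub>?A\<^esub> h) \<phi> = ?L (f \<otimes>\<^bsub>?A\<^esub> (g \<otimes>\<^bsub>?A\<^esub> h)) \<phi>" .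
      qed
    qed (rule onec)
    fix f g h
    assume f: "f \<in> carrier ?A" and g: "g \<in> carrier ?A" and h: "h \<in> carrier ?A"
    show "(f \<oplus>\<^bsub>?A\<^esub> g) \<otimes>\<^bsub>?A\<^esub> h = f \<otimes>\<^bsub>?A\<^esub> h \<oplus>\<^bsub>?A\<^esub> g \<otimes>\<^bsub>?A\<^esub> h"
    proof (rule monoid_algebra_eqI[OF mulc[OF addc[OF f g] h] addc[OF mulc[OF f h] mulc[OF g h]]])
      fix \<phi> assume \<phi>: "\<phi> \<in> carrier S \<rightarrow> carrier R"
      show "?L ((f \<oplus>\<^bsub>?A\<^esub> g) \<otimes>\<^bsub>?A\<^esub> h) \<phi> = ?L (f \<otimes>\<^bsub>?A\<^esub> h \<oplus>\<^bsub>?A\<^esub> g \<otimes>\<^bsub>?A\<^esub> h) \<phi>"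
        by (simp only: mult[OF addc[OF f g] h \<phi>] add[OF f g closed[OF h \<phi>]]
            add[OF mulc[OF f h] mulc[OF g h] \<phi>] mult[OF f h \<phi>] mult[OF g h \<phi>])
    qed
    show "h \<otimes>\<^bsub>?A\<^esub> (f \<oplus>\<^bsub>?A\<^esub> g) = h \<otimes>\<^bsub>?A\<^esub> f \<oplus>\<^bsub>?A\<^esub> h \<otimes>\<^bsub>?A\<^esub> g"
    proof (rule monoid_algebra_eqI[OF mulc[OF h addc[OF f g]] addc[OF mulc[OF h f] mulc[OF h g]]])
      fix \<phi> assume \<phi>: "\<phi> \<in> carrier S \<rightarrow> carrier R"
      have "?L (h \<otimes>\<^bsub>?A\<^esub> (f \<oplus>\<^bsub>?A\<^esub> g)) \<phi>
          = ?L h (\<lambda>s. ?L f (\<lambda>t. \<phi> (s \<otimes>\<^bsub>S\<^esub> t)) \<oplus> ?L g (\<lambda>t. \<phi> (s \<otimes>\<^bsub>S\<^esub> t)))"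
        unfolding mult[OF h addc[OF f g] \<phi>]
        using closed[OF addc[OF f g] \<phi>] add[OF f g shift[OF _ \<phi>]] by (rule cong[OF h])
      also have "\<dots> = ?L h (\<lambda>s. ?L f (\<lambda>t. \<phi> (s \<otimes>\<^bsub>S\<^esub> t))) \<oplus> ?L h (\<lambda>s. ?L g (\<lambda>t. \<phi> (s \<otimes>\<^bsub>S\<^esub> t)))"
        using N.lin_ext_add_right[OF h, of "\<lambda>s. ?L f (\<lambda>t. \<phi> (s \<otimes>\<^bsub>S\<^esub> t))"
            "\<lambda>s. ?L g (\<lambda>t. \<phi> (s \<otimes>\<^bsub>S\<^esub> t))"] closed[OF f \<phi>] closed[OF g \<phi>] by simp
      also have "\<dots> = ?L (h \<otimes>\<^bsub>?A\<^esub> f \<oplus>\<^bsub>?A\<^esub> h \<otimes>\<^bsub>?A\<^esub> g) \<phi>"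
        by (simp only: add[OF mulc[OF h f] mulc[OF h g] \<phi>] mult[OF h f \<phi>] mult[OF h g \<phi>])
      finally show "?L (h \<otimes>\<^bsub>?A\<^esub> (f \<oplus>\<^bsub>?A\<^esub> g)) \<phi> = ?L (h \<otimes>\<^bsub>?A\<^esub> f \<oplus>\<^bsub>?A\<^esub> h \<otimes>\<^bsub>?A\<^esub> g) \<phi>" .
    qed
  qed
qed

section \<open>The induced module and its invariants\<close>

context unital_partial_module
begin

section \<open>Action of S(G) on the algebra\<close>

lemma par_gen_closed: "g \<in> carrier G \<Longrightarrow> par_gen G g \<in> carrier (par_monoid G)"
  by (simp add: par_gen_def G.par_class_closed par_words_singleton)

text \<open>A class acts through a chosen representative; by \<open>word_act_cong\<close> the choice
  does not affect the operator on \<open>A\<close>.\<close>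

definition par_act :: "'g list set \<Rightarrow> 'a \<Rightarrow> 'a" where
  "par_act s a = word_act (SOME w. w \<in> s) a"

lemma par_act_class:
  assumes "u \<in> par_words G" "a \<in> carrier A"
  shows "par_act (par_rel G `` {u}) a = word_act u a"
proof -
  have "(SOME w. w \<in> par_rel G `` {u}) \<in> par_rel G `` {u}"
    by (rule someI[of _ u]) (simp add: par_rel.refl assms)
  then show ?thesis
    unfolding par_act_def using word_act_cong[of u _ a] assms by simp
qed

lemma par_words_lists: "u \<in> par_words G \<Longrightarrow> u \<in> lists (carrier G)"
  by (simp add: par_words_def)

lemma par_act_closed:
  assumes "s \<in> carrier (par_monoid G)" "a \<in> carrier A"
  shows "par_act s a \<in> carrier A"
  using assms(1)
  by (rule G.par_monoid_cases) (simp add: par_act_class word_act_closed par_words_lists assms)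

lemma par_act_add:
  assumes "s \<in> carrier (par_monoid G)" "a \<in> carrier A" "b \<in> carrier A"
  shows "par_act s (a \<oplus>\<^bsub>A\<^esub> b) = par_act s a \<oplus>\<^bsub>A\<^esub> par_act s b"
  using assms(1)
  by (rule G.par_monoid_cases) (simp add: par_act_class word_act_add par_words_lists assms)

lemma par_act_scale:
  assumes "s \<in> carrier (par_monoid G)" "k \<in> carrier K" "a \<in> carrier A"
  shows "par_act s (k \<odot>\<^bsub>A\<^esub> a) = k \<odot>\<^bsub>A\<^esub> par_act s a"
  using assms(1)
  by (rule G.par_monoid_cases) (simp add: par_act_class word_act_scale par_words_lists assms)

lemma par_act_mult:
  assumes "s \<in> carrier (par_monoid G)" "t \<in> carrier (par_monoid G)" "a \<in> carrier A"
  shows "par_act (s \<otimes>\<^bsub>par_monoid G\<^esub> t) a = par_act s (par_act t a)"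
  using assms(1,2)
  by (elim G.par_monoid_cases)
    (simp add: G.par_monoid_mult par_act_class par_words_append word_act_append word_act_closed
      par_words_lists assms(3))

lemma par_act_gen:
  assumes "g \<in> carrier G" "a \<in> carrier A"
  shows "par_act (par_gen G g) a = act g a"
  using assms by (simp add: par_gen_def par_act_class par_words_singleton word_act_def)

lemma par_act_one:
  assumes "a \<in> carrier A"
  shows "par_act \<one>\<^bsub>par_monoid G\<^esub> a = a"
  using par_act_gen[of "\<one>\<^bsub>G\<^esub>" a] assms act_one_left by (simp add: par_monoid_def)

section \<open>Existence of the induced module\<close>

definition act_module :: "('g list set \<Rightarrow> 'k, 'a) module" where
  "act_module = \<lparr>carrier = carrier A, monoid.mult = monoid.mult A, one = one A,
     ring.zero = ring.zero A, add = ring.add A,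
     smult = (\<lambda>f a. lin_ext K (par_monoid G) A f (\<lambda>s. par_act s a))\<rparr>"

lemma act_module_simps [simp]:
  "carrier act_module = carrier A" "ring.add act_module = ring.add A"
  "ring.zero act_module = ring.zero A"
  "f \<odot>\<^bsub>act_module\<^esub> a = lin_ext K (par_monoid G) A f (\<lambda>s. par_act s a)"
  by (simp_all add: act_module_def)

lemma par_act_funcset: "a \<in> carrier A \<Longrightarrow> (\<lambda>s. par_act s a) \<in> carrier (par_monoid G) \<rightarrow> carrier A"
  by (simp add: par_act_closed)

text \<open>Additivity in either argument is that of \<open>lin_ext\<close>. The associative law
  combines \<open>lin_ext_mult\<close>, the homomorphism property \<open>par_act_mult\<close>, and
  the fact that each operator commutes with linear extension.\<close>

lemma act_module_left_module: "left_module (K_par K G) act_module"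
proof -
  let ?S = "par_monoid G"
  let ?L = "lin_ext K ?S A"
  have "ring (K_par K G)"
    unfolding K_par_def by (rule K.monoid_algebra_ring[OF G.par_monoid_monoid])
  moreover have "abelian_group act_module"
    by (rule abelian_groupI) (auto simp: A.M.a_ac intro: A.M.l_neg)
  moreover have "left_module_axioms (K_par K G) act_module"
    unfolding K_par_def
  proof (rule left_module_axioms.intro; simp only: act_module_simps)
    fix f a assume f: "f \<in> carrier (monoid_algebra K ?S)" and a: "a \<in> carrier A"
    note pa = par_act_funcset[OF a]
    show "?L f (\<lambda>s. par_act s a) \<in> carrier A"
      by (rule A.lin_ext_closed[OF f pa])
    show "?L f (\<lambda>s. par_act s (a \<oplus>\<^bsub>A\<^esub> b)) = ?L f (\<lambda>s. par_act s a) \<oplus>\<^bsub>A\<^esub> ?L f (\<lambda>s. par_act s b)"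
      if b: "b \<in> carrier A" for b
    proof -
      have "?L f (\<lambda>s. par_act s (a \<oplus>\<^bsub>A\<^esub> b)) = ?L f (\<lambda>s. par_act s a \<oplus>\<^bsub>A\<^esub> par_act s b)"
        using a b by (intro A.lin_ext_cong[OF f par_act_funcset]) (auto simp: par_act_add)
      then show ?thesis
        using A.lin_ext_add_right[OF f pa par_act_funcset[OF b]] by simp
    qed
    fix g assume g: "g \<in> carrier (monoid_algebra K ?S)"
    show "?L (f \<oplus>\<^bsub>monoid_algebra K ?S\<^esub> g) (\<lambda>s. par_act s a)
        = ?L f (\<lambda>s. par_act s a) \<oplus>\<^bsub>A\<^esub> ?L g (\<lambda>s. par_act s a)"
      by (rule A.lin_ext_add_left[OF f g pa])
    have "?L (f \<otimes>\<^bsub>monoid_algebra K ?S\<^esub> g) (\<lambda>s. par_act s a)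
        = ?L f (\<lambda>s. ?L g (\<lambda>t. par_act (s \<otimes>\<^bsub>?S\<^esub> t) a))"
      by (rule A.lin_ext_mult[OF G.par_monoid_monoid f g pa])
    also have "\<dots> = ?L f (\<lambda>s. par_act s (?L g (\<lambda>t. par_act t a)))"
    proof (rule A.lin_ext_cong[OF f, symmetric])
      show "(\<lambda>s. par_act s (?L g (\<lambda>t. par_act t a))) \<in> carrier ?S \<rightarrow> carrier A"
        by (rule par_act_funcset[OF A.lin_ext_closed[OF g pa]])
      fix s assume s: "s \<in> carrier ?S"
      \<comment> \<open>The operator \<open>par_act s\<close> is \<open>K\<close>-linear, so it
        passes inside the extension over \<open>g\<close>.\<close>
      have "par_act s (?L g (\<lambda>t. par_act t a)) = ?L g (\<lambda>t. par_act s (par_act t a))"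
        using s by (intro A.lin_ext_linear[OF _ _ _ g pa])
          (auto simp: par_act_closed par_act_add par_act_scale)
      also have "\<dots> = ?L g (\<lambda>t. par_act (s \<otimes>\<^bsub>?S\<^esub> t) a)"
        using s a by (intro A.lin_ext_cong[OF g]) (auto simp: par_act_closed par_act_mult)
      finally show "par_act s (?L g (\<lambda>t. par_act t a)) = ?L g (\<lambda>t. par_act (s \<otimes>\<^bsub>?S\<^esub> t) a)" .
    qed
    finally show "?L (f \<otimes>\<^bsub>monoid_algebra K ?S\<^esub> g) (\<lambda>s. par_act s a)
        = ?L f (\<lambda>s. par_act s (?L g (\<lambda>t. par_act t a)))" .
  next
    fix a assume a: "a \<in> carrier A"
    have "\<one>\<^bsub>monoid_algebra K ?S\<^esub> = monomial K ?S \<one>\<^bsub>?S\<^esub>"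
      by (simp add: monoid_algebra_def)
    then show "?L \<one>\<^bsub>monoid_algebra K ?S\<^esub> (\<lambda>s. par_act s a) = a"
      using A.lin_ext_monomial[OF monoid.one_closed[OF G.par_monoid_monoid] par_act_funcset[OF a]]
        par_act_one a by simp
  qed
  ultimately show ?thesis
    by (simp add: left_module_def)
qed

lemma act_module_induced: "induced_par_module K G A e \<alpha> act_module"
  unfolding induced_par_module_def
proof (intro conjI ballI)
  show "left_module (K_par K G) act_module"
    by (rule act_module_left_module)
  let ?S = "par_monoid G"
  fix a assume a: "a \<in> carrier A"
  note pa = par_act_funcset[OF a]
  fix k assume k: "k \<in> carrier K"
  have one: "\<one>\<^bsub>K_par K G\<^esub> = monomial K ?S \<one>\<^bsub>?S\<^esub>"
    by (simp add: K_par_def monoid_algebra_def)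
  show "(k \<odot>\<^bsub>K_par K G\<^esub> \<one>\<^bsub>K_par K G\<^esub>) \<odot>\<^bsub>act_module\<^esub> a = k \<odot>\<^bsub>A\<^esub> a"
    unfolding one act_module_simps unfolding K_par_def
    using A.lin_ext_smult_left[OF k monomial_closed[OF K.ring_axioms] pa]
      A.lin_ext_monomial[OF monoid.one_closed[OF G.par_monoid_monoid] pa] par_act_one[OF a]
    by simp
next
  fix a g assume a: "a \<in> carrier A" and g: "g \<in> carrier G"
  show "monomial K (par_monoid G) (par_gen G g) \<odot>\<^bsub>act_module\<^esub> a
      = \<alpha> g (e (inv\<^bsub>G\<^esub> g) \<otimes>\<^bsub>A\<^esub> a)"
    using A.lin_ext_monomial[OF par_gen_closed[OF g] par_act_funcset[OF a]] par_act_gen[OF g a]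
    by (simp add: act_def)
qed simp_all

section \<open>Invariants and their units\<close>

lemma H0_par_eq:
  assumes "induced_par_module K G A e \<alpha> M"
  shows "H0_par K G M = {a \<in> carrier A. \<forall>g\<in>carrier G. act g a = e g \<otimes>\<^bsub>A\<^esub> a}"
proof -
  interpret M: left_module "K_par K G" M
    using assms by (simp add: induced_par_module_def)
  let ?m = "monomial K (par_monoid G)"
  have carr: "carrier M = carrier A"
    using assms by (simp add: induced_par_module_def)
  have gen: "?m (par_gen G g) \<odot>\<^bsub>M\<^esub> a = act g a" if "g \<in> carrier G" "a \<in> carrier A" for g a
    using assms that by (simp add: induced_par_module_def act_def)
  \<comment> \<open>In any module of this kind the idempotent acts as the composite for
    \<open>g\<close> and \<open>inv g\<close>, which \<open>act_act_inv\<close> evaluates. The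
    resulting description of the invariants is therefore the same for every
    \<open>M\<close>.\<close>
  have idem: "?m (par_idem G g) \<odot>\<^bsub>M\<^esub> a = e g \<otimes>\<^bsub>A\<^esub> a" if g: "g \<in> carrier G" and a: "a \<in> carrier A" for g a
  proof -
    have "?m (par_idem G g) = ?m (par_gen G g) \<otimes>\<^bsub>K_par K G\<^esub> ?m (par_gen G (inv\<^bsub>G\<^esub> g))"
      unfolding K_par_def par_idem_def
      using K.monomial_mult[OF G.par_monoid_monoid par_gen_closed par_gen_closed] g by simp
    moreover have "?m s \<in> carrier (K_par K G)" for s
      unfolding K_par_def by (rule monomial_closed[OF K.ring_axioms])
    ultimately have "?m (par_idem G g) \<odot>\<^bsub>M\<^esub> a
        = ?m (par_gen G g) \<odot>\<^bsub>M\<^esub> (?m (par_gen G (inv\<^bsub>G\<^esub> g)) \<odot>\<^bsub>M\<^esub> a)"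
      using M.smult_assoc a carr by simp
    then show ?thesis
      using gen act_act_inv g a by simp
  qed
  show ?thesis
    using gen idem carr by (auto simp: H0_par_def)
qed

text \<open>The unit is invariant because \<open>act g\<close> sends it to \<open>e g\<close>.
  Products use multiplicativity of \<open>act g\<close>, where one of the two idempotents is
  absorbed; the linear conditions use linearity of \<open>act g\<close>.\<close>

lemma invariants_subalgebra:
  "unital_subalgebra {a \<in> carrier A. \<forall>g\<in>carrier G. act g a = e g \<otimes>\<^bsub>A\<^esub> a} K A"
    (is "unital_subalgebra ?H K A")
proof -
  have one: "\<one>\<^bsub>A\<^esub> \<in> ?H"
    using act_one_right idem_closed by simp
  have mult: "a \<otimes>\<^bsub>A\<^esub> b \<in> ?H" if "a \<in> ?H" "b \<in> ?H" for a b
  proof -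
    have "act g (a \<otimes>\<^bsub>A\<^esub> b) = e g \<otimes>\<^bsub>A\<^esub> (a \<otimes>\<^bsub>A\<^esub> b)" if g: "g \<in> carrier G" for g
    proof -
      have ab: "a \<in> carrier A" "b \<in> carrier A" "act g a = e g \<otimes>\<^bsub>A\<^esub> a" "act g b = e g \<otimes>\<^bsub>A\<^esub> b"
        using \<open>a \<in> ?H\<close> \<open>b \<in> ?H\<close> g by auto
      \<comment> \<open>The idempotent coming from \<open>b\<close> is moved to
        \<open>act g a\<close>, which absorbs it.\<close>
      have "act g (a \<otimes>\<^bsub>A\<^esub> b) = (e g \<otimes>\<^bsub>A\<^esub> act g a) \<otimes>\<^bsub>A\<^esub> b"
        using act_distrib_mult ab g idem_closed by (simp add: A.m_ac)
      also have "e g \<otimes>\<^bsub>A\<^esub> act g a = e g \<otimes>\<^bsub>A\<^esub> a"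
        using idem_mult_act[OF g ab(1)] ab(3) by metis
      finally show ?thesis
        using ab g idem_closed by (simp add: A.m_assoc)
    qed
    then show ?thesis
      using that by simp
  qed
  have add: "a \<oplus>\<^bsub>A\<^esub> b \<in> ?H" if "a \<in> ?H" "b \<in> ?H" for a b
    using that act_add idem_closed by (simp add: A.r_distr)
  have scale: "k \<odot>\<^bsub>A\<^esub> a \<in> ?H" if "k \<in> carrier K" "a \<in> ?H" for k a
  proof -
    have "e g \<otimes>\<^bsub>A\<^esub> (k \<odot>\<^bsub>A\<^esub> a) = k \<odot>\<^bsub>A\<^esub> (e g \<otimes>\<^bsub>A\<^esub> a)" if "g \<in> carrier G" for g
      using A.smult_assoc2[of k a "e g"] that \<open>k \<in> carrier K\<close> \<open>a \<in> ?H\<close> idem_closed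
      by (simp add: A.m_comm)
    then show ?thesis
      using that act_scale by simp
  qed
  have neg: "\<ominus>\<^bsub>A\<^esub> a \<in> ?H" if "a \<in> ?H" for a
  proof -
    \<comment> \<open>Negation is scaling by minus one, so \<open>scale\<close> covers it.\<close>
    have "\<ominus>\<^bsub>A\<^esub> a = (\<ominus>\<^bsub>K\<^esub> \<one>\<^bsub>K\<^esub>) \<odot>\<^bsub>A\<^esub> a"
      using that A.smult_l_minus by simp
    then show ?thesis
      using scale[OF _ that] by simp
  qed
  have zero: "\<zero>\<^bsub>A\<^esub> \<in> ?H"
    using scale[OF K.zero_closed one] by simp
  have "subring ?H A"
    using one neg mult add by (intro A.subringI) auto
  moreover have "submodule ?H K A"
    using zero neg add scale by (intro A.submoduleI) auto
  ultimately show ?thesis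
    by (simp add: unital_subalgebra_def)
qed

text \<open>Uniqueness of inverses in the ideal of \<open>e g\<close>: there \<open>act g b\<close>
  is inverse to \<open>act g a\<close>, since their product is the image \<open>e g\<close> of the
  unit, while \<open>e g \<otimes> b\<close> is inverse to \<open>e g \<otimes> a\<close>.\<close>

lemma act_unit_inverse:
  assumes g: "g \<in> carrier G" and ab: "a \<in> carrier A" "b \<in> carrier A" "a \<otimes>\<^bsub>A\<^esub> b = \<one>\<^bsub>A\<^esub>"
    and a: "act g a = e g \<otimes>\<^bsub>A\<^esub> a"
  shows "act g b = e g \<otimes>\<^bsub>A\<^esub> b"
proof -
  have "act g b = (e g \<otimes>\<^bsub>A\<^esub> act g b) \<otimes>\<^bsub>A\<^esub> (a \<otimes>\<^bsub>A\<^esub> b)"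
    using idem_mult_act g ab by simp
  also have "\<dots> = (act g a \<otimes>\<^bsub>A\<^esub> act g b) \<otimes>\<^bsub>A\<^esub> b"
    unfolding a using g ab(1,2) idem_closed by (simp add: A.m_ac)
  also have "act g a \<otimes>\<^bsub>A\<^esub> act g b = e g"
    using act_distrib_mult[OF g ab(1,2)] ab(3) act_one_right[OF g] by simp
  finally show ?thesis .
qed

text \<open>An invariant that is a unit of \<open>A\<close> has an invariant inverse by
  \<open>act_unit_inverse\<close>. Conversely the subalgebra shares multiplication and unit with
  \<open>A\<close>, so its units are units of \<open>A\<close>.\<close>

lemma H0_eq_Units:
  "H0 G A e \<alpha> = Units (A\<lparr>carrier := {a \<in> carrier A. \<forall>g\<in>carrier G. act g a = e g \<otimes>\<^bsub>A\<^esub> a}\<rparr>)"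
    (is "_ = Units (A\<lparr>carrier := ?H\<rparr>)")
proof
  show "H0 G A e \<alpha> \<subseteq> Units (A\<lparr>carrier := ?H\<rparr>)"
  proof
    fix a assume a: "a \<in> H0 G A e \<alpha>"
    then obtain b where ab: "a \<in> carrier A" "b \<in> carrier A"
        "a \<otimes>\<^bsub>A\<^esub> b = \<one>\<^bsub>A\<^esub>" "b \<otimes>\<^bsub>A\<^esub> a = \<one>\<^bsub>A\<^esub>"
      by (auto simp: H0_def Units_def)
    have "a \<in> ?H"
      using a ab(1) by (simp add: H0_def act_def)
    moreover from this have "b \<in> ?H"
      using act_unit_inverse ab by simp
    ultimately show "a \<in> Units (A\<lparr>carrier := ?H\<rparr>)"
      using ab by (auto simp: Units_def)
  qed
  show "Units (A\<lparr>carrier := ?H\<rparr>) \<subseteq> H0 G A e \<alpha>"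
    by (auto simp: H0_def Units_def act_def)
qed

end

text \<open>The existence part, witnessed by \<open>act_module\<close>, keeps the statement about
  all induced modules from being vacuous. For each of them \<open>H0_par_eq\<close> reduces both
  claims to the explicit set of invariants.\<close>

theorem proposition2p1:
  fixes K :: "('k, 'p) ring_scheme"
    and G :: "('g, 'q) monoid_scheme"
    and A :: "('k, 'a, 'r) module_scheme"
    and e :: "'g \<Rightarrow> 'a"
    and \<alpha> :: "'g \<Rightarrow> 'a \<Rightarrow> 'a"
  assumes "unital_partial_module K G A e \<alpha>"
  shows "(\<exists>M. induced_par_module K G A e \<alpha> M) \<and>
    (\<forall>M. induced_par_module K G A e \<alpha> M \<longrightarrow>
      unital_subalgebra (H0_par K G M) K A \<and>
      H0 G A e \<alpha> = Units (A\<lparr>carrier := H0_par K G M\<rparr>))"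
proof -
  interpret unital_partial_module K G A e \<alpha>
    by fact
  show ?thesis
    using act_module_induced invariants_subalgebra H0_eq_Units H0_par_eq by auto
qed

end
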